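(* There exists a universal constant $c\in(0,\infty)$ such that for every $\alpha\in(1/2,1]$ the following hold. For every $n\in\mathbb{N}$, $$e^\alpha(\ell_\infty,\ell_2^n)\ge c\left(n^{\frac{2\alpha-1}{4\alpha}}+n^{\alpha^2-\frac12}\right),$$ and for every integer $n\ge 3$, $$e^\alpha_n(\ell_\infty,\ell_2)\ge c\left((\log n)^{\frac{2\alpha-1}{4\alpha}}+\left(\frac{\log n}{\log\log n}\right)^{\alpha^2-\frac12}\right).$$
   Context: For metric spaces $(X,d_X)$, $(Z,d_Z)$ and $\alpha\in(0,1]$, the $\alpha$-H\"older constant $\|f\|_{\mathrm{Lip}(\alpha)}$ of $f:X\to Z$ is the infimum over $L\in(0,\infty]$ such that $d_Z(f(x),f(y))\le L\,d_X(x,y)^\alpha$ for all $x,y\in X$. For nonempty $S\subseteq X$, $e^\alpha(X,S,Z)$ is the infimum over those $K\in(0,\infty]$ such that for every $\alpha$-H\"older $f:S\to Z$ there exists $F:X\to Z$ with $F|_S=f$ and $\|F\|_{\mathrm{Lip}(\alpha)}\le K\|f\|_{\mathrm{Lip}(\alpha)}$. Then $e^\alpha(X,Z)$ is the supremum of $e^\alpha(X,S,Z)$ over all nonempty $S\subseteq X$, and $e^\alpha_n(X,Z)$ is the supremum over all such $S$ with $|S|\le n$. Here $\ell_\infty$, $\ell_2$ are the usual real sequence spaces and $\ell_2^n$ is $n$-dimensional Euclidean space. *)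

theory Defs
  imports "HOL-Analysis.Analysis"
begin

section \<open>Hoelder constants and Hoelder extension moduli\<close>

text \<open>
  All quantities below take values in the extended nonnegative reals, where \<open>\<infinity> * 0 = 0\<close>. Under
  this convention \<open>L = \<infinity>\<close> is always admissible, since distance 0 in X forces distance 0 between
  the images; and so is \<open>K = \<infinity>\<close>, since a function of Hoelder constant 0 on a nonempty set is
  constant and extends to a constant function. A map between metric spaces is a
  HOL function of which only the values on the carrier of the first space matter.
\<close>

definition holder_const ::
    "real \<Rightarrow> 'a metric \<Rightarrow> 'b metric \<Rightarrow> ('a \<Rightarrow> 'b) \<Rightarrow> ennreal" where
  "holder_const \<alpha> X Z f =
     Inf {L. 0 < L \<and> (\<forall>x \<in> mspace X. \<forall>y \<in> mspace X.
            ennreal (mdist Z (f x) (f y)) \<le> L * ennreal (mdist X x y powr \<alpha>))}"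

definition holder_on ::
    "real \<Rightarrow> 'a metric \<Rightarrow> 'b metric \<Rightarrow> ('a \<Rightarrow> 'b) \<Rightarrow> bool" where
  "holder_on \<alpha> X Z f \<longleftrightarrow> f \<in> mspace X \<rightarrow> mspace Z \<and> holder_const \<alpha> X Z f < \<infinity>"

definition ext_modulus_from ::
    "real \<Rightarrow> 'a metric \<Rightarrow> 'a set \<Rightarrow> 'b metric \<Rightarrow> ennreal" where
  "ext_modulus_from \<alpha> X S Z =
     Inf {K. 0 < K \<and> (\<forall>f. holder_on \<alpha> (submetric X S) Z f \<longrightarrow>
            (\<exists>F \<in> mspace X \<rightarrow> mspace Z. (\<forall>x\<in>S. F x = f x) \<and>
               holder_const \<alpha> X Z F \<le> K * holder_const \<alpha> (submetric X S) Z f))}"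

definition ext_modulus :: "real \<Rightarrow> 'a metric \<Rightarrow> 'b metric \<Rightarrow> ennreal" where
  "ext_modulus \<alpha> X Z =
     (SUP S \<in> {S. S \<subseteq> mspace X \<and> S \<noteq> {}}. ext_modulus_from \<alpha> X S Z)"

definition ext_modulus_card :: "nat \<Rightarrow> real \<Rightarrow> 'a metric \<Rightarrow> 'b metric \<Rightarrow> ennreal" where
  "ext_modulus_card n \<alpha> X Z =
     (SUP S \<in> {S. S \<subseteq> mspace X \<and> S \<noteq> {} \<and> finite S \<and> card S \<le> n}. ext_modulus_from \<alpha> X S Z)"


section \<open>The sequence spaces\<close>

text \<open>
  Bounded real sequences with the supremum metric are the bounded continuous functions on the
  discrete space of natural numbers.
\<close>

definition ell_infty :: "(nat \<Rightarrow>\<^sub>C real) metric" where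
  "ell_infty = euclidean_metric"

lemma mspace_ell_infty [simp]: "mspace ell_infty = UNIV"
  by (simp add: ell_infty_def)

lemma mdist_ell_infty: "mdist ell_infty x y = (SUP i. \<bar>apply_bcontfun x i - apply_bcontfun y i\<bar>)"
  by (simp add: ell_infty_def dist_bcontfun_def dist_real_def)

lemma range_apply_bcontfun_nat:
  "range (apply_bcontfun :: (nat \<Rightarrow>\<^sub>C real) \<Rightarrow> nat \<Rightarrow> real) = {x. bounded (range x)}"
proof -
  have "x \<in> range (apply_bcontfun :: (nat \<Rightarrow>\<^sub>C real) \<Rightarrow> nat \<Rightarrow> real)" if "bounded (range x)" for x
  proof -
    have "x \<in> bcontfun"
      using that by (simp add: bcontfun_def)
    then show ?thesis
      by (metis Bcontfun_inverse rangeI)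
  qed
  then show ?thesis
    by auto
qed

definition ell2_carrier :: "(nat \<Rightarrow> real) set" where
  "ell2_carrier = {x. (\<lambda>i. (x i)\<^sup>2) summable_on UNIV}"

definition ell2_dist :: "(nat \<Rightarrow> real) \<Rightarrow> (nat \<Rightarrow> real) \<Rightarrow> real" where
  "ell2_dist x y = sqrt (\<Sum>\<^sub>\<infinity>i. (x i - y i)\<^sup>2)"

definition ell2 :: "(nat \<Rightarrow> real) metric" where
  "ell2 = metric (ell2_carrier, ell2_dist)"

text \<open>
  As for \<^const>\<open>Euclidean_space\<close>, points of n-space are the sequences vanishing from index n on.
\<close>

definition ell2_dim :: "nat \<Rightarrow> (nat \<Rightarrow> real) metric" where
  "ell2_dim n =
     metric (topspace (Euclidean_space n), \<lambda>x y. L2_set (\<lambda>i. x i - y i) {..<n})"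

lemma summable_on_diff_square:
  fixes x y :: "nat \<Rightarrow> real"
  assumes "x \<in> ell2_carrier" "y \<in> ell2_carrier"
  shows "(\<lambda>i. (x i - y i)\<^sup>2) summable_on UNIV"
proof (rule summable_on_comparison_test)
  show "(\<lambda>i. 2 * (x i)\<^sup>2 + 2 * (y i)\<^sup>2) summable_on UNIV"
    using assms unfolding ell2_carrier_def
    by (intro summable_on_add summable_on_cmult_right) auto
  show "(x i - y i)\<^sup>2 \<le> 2 * (x i)\<^sup>2 + 2 * (y i)\<^sup>2" for i
    using zero_le_power2[of "x i + y i"] by (simp add: power2_eq_square algebra_simps)
qed auto

lemma L2_set_LIMSEQ_ell2_dist:
  assumes "x \<in> ell2_carrier" "y \<in> ell2_carrier"
  shows "(\<lambda>n. L2_set (\<lambda>i. x i - y i) {..<n}) \<longlonglongrightarrow> ell2_dist x y"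
proof -
  have "(\<lambda>i. (x i - y i)\<^sup>2) sums (\<Sum>\<^sub>\<infinity>i. (x i - y i)\<^sup>2)"
    using summable_on_diff_square[OF assms] by (intro has_sum_imp_sums has_sum_infsum)
  then show ?thesis
    unfolding L2_set_def ell2_dist_def sums_def by (rule tendsto_real_sqrt)
qed

lemma L2_set_diff_triangle:
  fixes x y z :: "nat \<Rightarrow> real"
  shows "L2_set (\<lambda>i. x i - z i) A \<le> L2_set (\<lambda>i. x i - y i) A + L2_set (\<lambda>i. y i - z i) A"
  using L2_set_triangle_ineq[of "\<lambda>i. x i - y i" "\<lambda>i. y i - z i" A] by simp

lemma Metric_space_ell2: "Metric_space ell2_carrier ell2_dist"
proof
  show "0 \<le> ell2_dist x y" for x y
    by (simp add: ell2_dist_def infsum_nonneg)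
  show "ell2_dist x y = ell2_dist y x" for x y
    by (simp add: ell2_dist_def power2_commute)
  show "ell2_dist x y = 0 \<longleftrightarrow> x = y" if xy: "x \<in> ell2_carrier" "y \<in> ell2_carrier" for x y
  proof
    assume "ell2_dist x y = 0"
    then have 0: "(\<Sum>\<^sub>\<infinity>i. (x i - y i)\<^sup>2) = 0"
      by (simp add: ell2_dist_def)
    have "(x i - y i)\<^sup>2 = 0" for i
      by (rule nonneg_infsum_le_0D[OF _ summable_on_diff_square[OF xy]]) (use 0 in auto)
    then show "x = y"
      by auto
  qed (simp add: ell2_dist_def)
  show "ell2_dist x z \<le> ell2_dist x y + ell2_dist y z"
    if "x \<in> ell2_carrier" "y \<in> ell2_carrier" "z \<in> ell2_carrier" for x y z
    using that
    by (intro LIMSEQ_le[OF L2_set_LIMSEQ_ell2_dist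
          tendsto_add[OF L2_set_LIMSEQ_ell2_dist L2_set_LIMSEQ_ell2_dist]])
       (auto intro: L2_set_diff_triangle)
qed

lemma mspace_ell2 [simp]: "mspace ell2 = ell2_carrier"
  and mdist_ell2 [simp]: "mdist ell2 = ell2_dist"
  by (simp_all add: ell2_def Metric_space_ell2 Metric_space.mspace_metric
      Metric_space.mdist_metric)

lemma Metric_space_ell2_dim:
  "Metric_space (topspace (Euclidean_space n)) (\<lambda>x y. L2_set (\<lambda>i. x i - y i) {..<n})"
proof
  fix x y z :: "nat \<Rightarrow> real"
  show "0 \<le> L2_set (\<lambda>i. x i - y i) {..<n}"
    by simp
  show "L2_set (\<lambda>i. x i - y i) {..<n} = L2_set (\<lambda>i. y i - x i) {..<n}"
    by (simp add: L2_set_def power2_commute)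
  show "L2_set (\<lambda>i. x i - z i) {..<n}
          \<le> L2_set (\<lambda>i. x i - y i) {..<n} + L2_set (\<lambda>i. y i - z i) {..<n}"
    by (rule L2_set_diff_triangle)
  assume xy: "x \<in> topspace (Euclidean_space n)" "y \<in> topspace (Euclidean_space n)"
  show "L2_set (\<lambda>i. x i - y i) {..<n} = 0 \<longleftrightarrow> x = y"
  proof
    assume "L2_set (\<lambda>i. x i - y i) {..<n} = 0"
    then have eq: "x i = y i" if "i < n" for i
      using that by (simp add: L2_set_eq_0_iff)
    show "x = y"
    proof
      show "x i = y i" for i
        using eq[of i] xy by (cases "i < n") (simp_all add: topspace_Euclidean_space)
    qed
  qed (simp add: L2_set_def)
qed

lemma mspace_ell2_dim [simp]: "mspace (ell2_dim n) = {x. \<forall>i\<ge>n. x i = 0}"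
  and mdist_ell2_dim [simp]: "mdist (ell2_dim n) x y = L2_set (\<lambda>i. x i - y i) {..<n}"
  unfolding ell2_dim_def
  by (simp_all only: Metric_space.mspace_metric[OF Metric_space_ell2_dim]
      Metric_space.mdist_metric[OF Metric_space_ell2_dim])
    (simp_all only: topspace_Euclidean_space)

end

theory Submission
  imports Defs
begin

text \<open>
  Both lower bounds come from integer lattices with the \<open>\<ell>\<^sub>1\<close> metric, which embed isometrically
  into \<open>\<ell>\<^sub>\<infinity>\<close>, and from one summation by parts on a box: if \<open>G\<close> is close in \<open>\<ell>\<^sub>2\<close> to the identity on the
  box, then its increments \<open>G\<^sub>i(z + e\<^sub>i) - G\<^sub>i(z)\<close> cannot all be small.

  First term. Let \<open>S\<close> be a maximal \<open>a\<close>-separated subset of the cube \<open>{0,1}\<^sup>n\<close> with the Hamming metric, and \<open>f\<close>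
  the identity from \<open>S\<close> to Euclidean space; its \<open>\<alpha>\<close>-Hoelder constant is at most \<open>a\<close> to the power \<open>1/2 - \<alpha>\<close>.
  The choice of \<open>a\<close> proportional to \<open>n\<close> to the power \<open>1/(2\<alpha>)\<close> makes the error \<open>H a\<^sup>\<alpha>\<close> of an extension of Hoelder
  constant \<open>H\<close> comparable to \<open>H sqrt n\<close>.

  Second term. Let \<open>B\<close> be an \<open>M \<times> n\<close> sign matrix, with \<open>M\<close> of order \<open>n\<close> to the power \<open>3/2\<close>, such that the \<open>\<ell>\<^sub>1\<close> norm
  of \<open>Bz\<close> is comparable to \<open>M\<close> times the Euclidean norm of \<open>z\<close> for all differences \<open>z\<close> of points of a grid, and
  let \<open>f(Bz) = z\<close>. Average an extension \<open>F\<close> over cubes of side \<open>J\<close> in the lattice. A step \<open>Be\<^sub>i\<close> is a sum of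
  \<open>M\<close> unit steps, along each of which the average moves by at most \<open>H J\<^sup>\<alpha> / J\<close>, while averaging displaces it by at
  most \<open>H (MJ)\<^sup>\<alpha>\<close>. A total displacement of order \<open>n\<close> over the \<open>n\<close> directions forces \<open>H\<close> to be large, and \<open>J\<close>
  is chosen to balance the two errors. The grid has \<open>exp(O(n log n))\<close> points.
\<close>

section \<open>Lattices in the space of bounded sequences\<close>

definition ldist :: "nat \<Rightarrow> (nat \<Rightarrow> int) \<Rightarrow> (nat \<Rightarrow> int) \<Rightarrow> real" where
  "ldist M v w = (\<Sum>k<M. \<bar>real_of_int (v k - w k)\<bar>)"

lemma ldist_nonneg [simp]: "0 \<le> ldist M v w"
  by (simp add: ldist_def sum_nonneg)

lemma ldist_self [simp]: "ldist M v v = 0"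
  by (simp add: ldist_def)

lemma ldist_commute: "ldist M v w = ldist M w v"
  by (simp add: ldist_def abs_minus_commute)

lemma ldist_triangle: "ldist M u w \<le> ldist M u v + ldist M v w"
  unfolding ldist_def sum.distrib[symmetric] by (rule sum_mono) linarith

text \<open>Frechet embedding: the coordinates are the distances to the points of a countable set,
  with those of the base point \<open>q 0\<close> subtracted to make them bounded. Density takes the
  form of distance 0 from \<open>C\<close>, so the supremum is attained at a coordinate.\<close>

lemma pseudometric_embedding_ell_infty:
  fixes d :: "'p \<Rightarrow> 'p \<Rightarrow> real"
  assumes "\<And>p. d p p = 0" and sym: "\<And>p q. d p q = d q p"
    and tri: "\<And>p q r. d p r \<le> d p q + d q r"
    and "countable C" and dense: "\<And>p. \<exists>c\<in>C. d p c = 0"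
  obtains e :: "'p \<Rightarrow> (nat \<Rightarrow>\<^sub>C real)" where "\<And>p q. dist (e p) (e q) = d p q"
proof -
  define q where "q = from_nat_into C"
  have "C \<noteq> {}"
    using dense by blast
  then have range_q: "range q = C"
    by (simp add: q_def \<open>countable C\<close>)
  define e where "e p = Bcontfun (\<lambda>i. d p (q i) - d (q 0) (q i))" for p
  have e: "apply_bcontfun (e p) i = d p (q i) - d (q 0) (q i)" for p i
  proof -
    have "\<bar>d p (q i) - d (q 0) (q i)\<bar> \<le> d p (q 0)" for i
      using tri[of p "q i" "q 0"] tri[of "q 0" "q i" p] sym[of p "q 0"] by linarith
    then have "bounded (range (\<lambda>i. d p (q i) - d (q 0) (q i)))"
      by (auto intro!: boundedI)
    then have "(\<lambda>i. d p (q i) - d (q 0) (q i)) \<in> bcontfun"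
      by (simp add: bcontfun_def)
    then show ?thesis
      by (simp add: e_def Bcontfun_inverse)
  qed
  have "dist (e p) (e r) = d p r" for p r
  proof (rule antisym)
    show "dist (e p) (e r) \<le> d p r"
    proof (rule dist_bound)
      fix i
      show "dist (apply_bcontfun (e p) i) (apply_bcontfun (e r) i) \<le> d p r"
        using tri[of p "q i" r] tri[of r "q i" p] sym[of p r] by (simp add: e dist_real_def)
    qed
    obtain c where "c \<in> C" "d r c = 0"
      using dense by blast
    then obtain i where i: "q i = c"
      using range_q by blast
    have "d p r \<le> d p c"
      using tri[of p r c] sym[of r c] \<open>d r c = 0\<close> by linarith
    also have "\<dots> = \<bar>apply_bcontfun (e p) i - apply_bcontfun (e r) i\<bar>"
    proof -
      have "0 \<le> d p c"
        using tri[of p p c] sym[of c p] tri[of p c p] assms(1)[of p] by linarith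
      then show ?thesis
        using i \<open>d r c = 0\<close> by (simp add: e)
    qed
    also have "\<dots> \<le> dist (e p) (e r)"
      using dist_bounded[of "e p" i "e r"] by (simp add: dist_real_def)
    finally show "d p r \<le> dist (e p) (e r)" .
  qed
  then show thesis
    by (rule that)
qed

text \<open>\<open>ldist M\<close> ignores the entries from \<open>M\<close> on, so every point is
  at distance 0 from its restriction to \<open>{..<M}\<close>, and these restrictions form a
  countable set.\<close>

lemma lattice_embedding_ell_infty:
  obtains e :: "(nat \<Rightarrow> int) \<Rightarrow> (nat \<Rightarrow>\<^sub>C real)"
  where "\<And>v w. dist (e v) (e w) = ldist M v w"
proof (rule pseudometric_embedding_ell_infty[of "ldist M" "PiE {..<M} (\<lambda>_. UNIV)"])
  show "countable (PiE {..<M} (\<lambda>_. UNIV :: int set))"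
    by (intro countable_PiE) auto
  show "\<exists>c\<in>PiE {..<M} (\<lambda>_. UNIV). ldist M p c = 0" for p
    by (intro bexI[of _ "restrict p {..<M}"]) (auto simp: ldist_def)
qed (auto intro: that ldist_triangle ldist_commute)

text \<open>Properties shared by \<open>ell2_dim n\<close> and \<open>ell2\<close>, so that one
  argument serves both halves of the theorem. The last clause says that truncation to the first
  \<open>n\<close> coordinates does not increase distances.\<close>

definition contains_euclidean :: "nat \<Rightarrow> (nat \<Rightarrow> real) metric \<Rightarrow> bool" where
  "contains_euclidean n Z \<longleftrightarrow>
     (\<forall>x. (\<forall>i\<ge>n. x i = 0) \<longrightarrow> x \<in> mspace Z) \<and>
     (\<forall>x y. (\<forall>i\<ge>n. x i = 0) \<longrightarrow> (\<forall>i\<ge>n. y i = 0) \<longrightarrow>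
        mdist Z x y = L2_set (\<lambda>i. x i - y i) {..<n}) \<and>
     (\<forall>x\<in>mspace Z. \<forall>y\<in>mspace Z. L2_set (\<lambda>i. x i - y i) {..<n} \<le> mdist Z x y)"

lemma contains_euclidean_ell2_dim: "contains_euclidean n (ell2_dim n)"
  by (simp add: contains_euclidean_def)

lemma contains_euclidean_ell2: "contains_euclidean n ell2"
  unfolding contains_euclidean_def
proof (intro conjI allI impI ballI)
  fix x :: "nat \<Rightarrow> real" assume x: "\<forall>i\<ge>n. x i = 0"
  have "(\<lambda>i. (x i)\<^sup>2) summable_on UNIV \<longleftrightarrow> (\<lambda>i. (x i)\<^sup>2) summable_on {..<n}"
    by (rule summable_on_cong_neutral) (use x in \<open>auto simp: not_less\<close>)
  then show "x \<in> mspace ell2"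
    by (simp add: ell2_carrier_def)
  fix y :: "nat \<Rightarrow> real" assume y: "\<forall>i\<ge>n. y i = 0"
  have "(\<Sum>\<^sub>\<infinity>i. (x i - y i)\<^sup>2) = (\<Sum>\<^sub>\<infinity>i\<in>{..<n}. (x i - y i)\<^sup>2)"
    by (rule infsum_cong_neutral) (use x y in \<open>auto simp: not_less\<close>)
  then show "mdist ell2 x y = L2_set (\<lambda>i. x i - y i) {..<n}"
    by (simp add: ell2_dist_def L2_set_def)
next
  fix x y assume "x \<in> mspace ell2" "y \<in> mspace ell2"
  then have "(\<Sum>i<n. (x i - y i)\<^sup>2) \<le> (\<Sum>\<^sub>\<infinity>i. (x i - y i)\<^sup>2)"
    using summable_on_diff_square[of x y] by (intro finite_sum_le_infsum) auto
  then show "L2_set (\<lambda>i. x i - y i) {..<n} \<le> mdist ell2 x y"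
    by (simp add: ell2_dist_def L2_set_def)
qed

section \<open>Reduction of the extension modulus to maps on a lattice\<close>

lemma holder_const_le:
  assumes "0 < L" "\<And>x y. x \<in> mspace X \<Longrightarrow> y \<in> mspace X \<Longrightarrow> mdist Z (f x) (f y) \<le> L * mdist X x y powr \<alpha>"
  shows "holder_const \<alpha> X Z f \<le> ennreal L"
  unfolding holder_const_def
  using assms by (intro Inf_lower) (auto simp flip: ennreal_mult')

text \<open>Strictness of the hypothesis provides an admissible constant below \<open>H\<close>
  without discussing whether the infimum is attained.\<close>

lemma holder_const_less:
  assumes "holder_const \<alpha> X Z f < ennreal H" "x \<in> mspace X" "y \<in> mspace X"
  shows "mdist Z (f x) (f y) \<le> H * mdist X x y powr \<alpha>"
proof -
  obtain L where L: "L < ennreal H"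
    "ennreal (mdist Z (f x) (f y)) \<le> L * ennreal (mdist X x y powr \<alpha>)"
    using assms unfolding holder_const_def Inf_less_iff by blast
  have "0 \<le> H"
    using L(1) by (cases "0 \<le> H") (auto simp: ennreal_neg)
  have "ennreal (mdist Z (f x) (f y)) \<le> ennreal H * ennreal (mdist X x y powr \<alpha>)"
    using L by (meson less_imp_le mult_right_mono order_trans zero_le)
  also have "\<dots> = ennreal (H * mdist X x y powr \<alpha>)"
    using \<open>0 \<le> H\<close> by (simp add: ennreal_mult)
  finally show ?thesis
    using \<open>0 \<le> H\<close> by (simp add: ennreal_le_iff)
qed

text \<open>\<open>T\<close> is a set of labels, \<open>pos\<close> places them in the lattice and
  \<open>\<phi>\<close> prescribes the values. An extension to \<open>ell_infty\<close> pulls back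
  along the embedding to the whole lattice, so it suffices to bound from below the Hoelder constants
  of lattice maps with the prescribed values.\<close>

lemma ext_modulus_from_lower:
  fixes pos :: "'t \<Rightarrow> nat \<Rightarrow> int" and \<phi> :: "'t \<Rightarrow> nat \<Rightarrow> real"
  assumes Z: "contains_euclidean n Z" and T: "finite T" "T \<noteq> {}"
    and \<Lambda>: "0 < \<Lambda>" and supp: "\<And>t i. t \<in> T \<Longrightarrow> n \<le> i \<Longrightarrow> \<phi> t i = 0"
    and hol: "\<And>s t. s \<in> T \<Longrightarrow> t \<in> T \<Longrightarrow>
      L2_set (\<lambda>i. \<phi> s i - \<phi> t i) {..<n} \<le> \<Lambda> * ldist M (pos s) (pos t) powr \<alpha>"
    and low: "\<And>F H. 0 < H \<Longrightarrow> (\<And>t i. t \<in> T \<Longrightarrow> i < n \<Longrightarrow> F (pos t) i = \<phi> t i) \<Longrightarrow>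
      (\<And>v w. L2_set (\<lambda>i. F v i - F w i) {..<n} \<le> H * ldist M v w powr \<alpha>) \<Longrightarrow> \<kappa> * \<Lambda> \<le> H"
  obtains S where "S \<noteq> {}" "finite S" "card S \<le> card T"
    "ennreal \<kappa> \<le> ext_modulus_from \<alpha> ell_infty S Z"
proof -
  obtain e :: "(nat \<Rightarrow> int) \<Rightarrow> (nat \<Rightarrow>\<^sub>C real)"
    where e: "\<And>v w. dist (e v) (e w) = ldist M v w"
    using lattice_embedding_ell_infty[of M] by blast
  define S where "S = (\<lambda>t. e (pos t)) ` T"
  define f where "f = (\<lambda>x. \<phi> (inv_into T (\<lambda>t. e (pos t)) x))"
  \<comment> \<open>Labels may share an image point; the Hoelder hypothesis at distance 0 then
    forces equal values, so the choice made by \<open>inv_into\<close> does not matter.\<close>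
  have f: "f (e (pos t)) i = \<phi> t i" if "t \<in> T" for t i
  proof -
    define s where "s = inv_into T (\<lambda>t. e (pos t)) (e (pos t))"
    have s: "s \<in> T" "e (pos s) = e (pos t)"
      using that f_inv_into_f[of "e (pos t)" "\<lambda>t. e (pos t)" T]
      by (auto simp: s_def inv_into_into)
    then have "ldist M (pos s) (pos t) = 0"
      by (metis dist_self e)
    with hol[OF s(1) that] have "L2_set (\<lambda>i. \<phi> s i - \<phi> t i) {..<n} = 0"
      using L2_set_nonneg[of "\<lambda>i. \<phi> s i - \<phi> t i" "{..<n}"] by simp
    then have "\<phi> s i = \<phi> t i" if "i < n"
      using that by (simp add: L2_set_eq_0_iff)
    moreover have "\<phi> s i = \<phi> t i" if "\<not> i < n"
      using supp[of s i] supp[of t i] s \<open>t \<in> T\<close> that by simp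
    ultimately show ?thesis
      by (auto simp: f_def s_def)
  qed
  have fm: "f x \<in> mspace Z" and f0: "\<And>i. n \<le> i \<Longrightarrow> f x i = 0" if "x \<in> S" for x
    using Z that f supp unfolding contains_euclidean_def S_def by auto
  have sub: "mspace (submetric ell_infty S) = S" "mdist (submetric ell_infty S) = dist"
    by (simp_all add: mspace_submetric mdist_submetric) (simp add: ell_infty_def)
  have cf: "holder_const \<alpha> (submetric ell_infty S) Z f \<le> ennreal \<Lambda>"
  proof (rule holder_const_le[OF \<Lambda>], unfold sub)
    fix x y assume xy: "x \<in> S" "y \<in> S"
    then obtain s t where st: "s \<in> T" "t \<in> T" "x = e (pos s)" "y = e (pos t)"
      by (auto simp: S_def)
    have "mdist Z (f x) (f y) = L2_set (\<lambda>i. f x i - f y i) {..<n}"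
      using Z f0[OF xy(1)] f0[OF xy(2)] unfolding contains_euclidean_def by blast
    then show "mdist Z (f x) (f y) \<le> \<Lambda> * dist x y powr \<alpha>"
      using hol[OF st(1,2)] st f by (simp add: e)
  qed
  have holf: "holder_on \<alpha> (submetric ell_infty S) Z f"
    using cf fm by (auto simp: holder_on_def sub intro: order_le_less_trans)
  have "ennreal \<kappa> \<le> K"
    if K: "0 < K" "\<forall>f. holder_on \<alpha> (submetric ell_infty S) Z f \<longrightarrow>
            (\<exists>F \<in> mspace ell_infty \<rightarrow> mspace Z. (\<forall>x\<in>S. F x = f x) \<and>
               holder_const \<alpha> ell_infty Z F \<le> K * holder_const \<alpha> (submetric ell_infty S) Z f)" for K
  proof (cases K)
    case (real k)
    obtain F where F: "F \<in> mspace ell_infty \<rightarrow> mspace Z" "\<And>x. x \<in> S \<Longrightarrow> F x = f x"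
      "holder_const \<alpha> ell_infty Z F \<le> K * holder_const \<alpha> (submetric ell_infty S) Z f"
      using K(2) holf by blast
    have "holder_const \<alpha> ell_infty Z F \<le> ennreal k * ennreal \<Lambda>"
      using F(3) cf real by (metis mult_left_mono order_trans zero_le)
    then have cF: "holder_const \<alpha> ell_infty Z F \<le> ennreal (k * \<Lambda>)"
      using \<Lambda> real by (simp add: ennreal_mult)
    \<comment> \<open>Working with every \<open>H\<close> above \<open>k * \<Lambda>\<close>
      supplies the strict bound that \<open>holder_const_less\<close> needs; \<open>dense_ge\<close>
      then passes to the limit.\<close>
    have "\<kappa> * \<Lambda> \<le> H" if H: "k * \<Lambda> < H" for H
    proof (rule low[of H "\<lambda>v. F (e v)"])
      show "0 < H"
        using H real \<Lambda> by (smt (verit) mult_nonneg_nonneg)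
      then have H': "holder_const \<alpha> ell_infty Z F < ennreal H"
        using cF H by (meson ennreal_lessI order_le_less_trans)
      show "F (e (pos t)) i = \<phi> t i" if "t \<in> T" "i < n" for t i
        using that F(2) f by (simp add: S_def)
      show "L2_set (\<lambda>i. F (e v) i - F (e w) i) {..<n} \<le> H * ldist M v w powr \<alpha>" for v w
      proof -
        have "L2_set (\<lambda>i. F (e v) i - F (e w) i) {..<n} \<le> mdist Z (F (e v)) (F (e w))"
          using Z funcset_mem[OF F(1), of "e v"] funcset_mem[OF F(1), of "e w"]
          unfolding contains_euclidean_def by simp
        also have "\<dots> \<le> H * mdist ell_infty (e v) (e w) powr \<alpha>"
          by (rule holder_const_less[OF H']) auto
        finally show ?thesis
          by (simp add: ell_infty_def e)
      qed
    qed
    then have "\<kappa> * \<Lambda> \<le> k * \<Lambda>"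
      by (rule dense_ge)
    then show ?thesis
      using \<Lambda> real by (simp add: ennreal_leI)
  qed simp
  then have "ennreal \<kappa> \<le> ext_modulus_from \<alpha> ell_infty S Z"
    unfolding ext_modulus_from_def by (intro Inf_greatest) blast
  then show thesis
    using T by (intro that[of S]) (auto simp: S_def card_image_le)
qed

section \<open>Summation by parts on a box\<close>

definition int_box :: "nat \<Rightarrow> nat \<Rightarrow> (nat \<Rightarrow> int) set" where
  "int_box n m = {z. (\<forall>i<n. 0 \<le> z i \<and> z i < int m) \<and> (\<forall>i\<ge>n. z i = 0)}"

lemma int_box_eq_image:
  "int_box n m = (\<lambda>g i. if i < n then g i else 0) ` PiE {..<n} (\<lambda>_. {0..<int m})" (is "_ = ?r ` ?P")
proof
  show "int_box n m \<subseteq> ?r ` ?P"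
  proof
    fix z assume z: "z \<in> int_box n m"
    have "z = ?r (restrict z {..<n})"
      using z by (auto simp: int_box_def fun_eq_iff)
    moreover have "restrict z {..<n} \<in> ?P"
      using z by (intro restrict_PiE_iff[THEN iffD2]) (simp add: int_box_def)
    ultimately show "z \<in> ?r ` ?P"
      by blast
  qed
  show "?r ` ?P \<subseteq> int_box n m"
    by (auto simp: int_box_def PiE_def Pi_def)
qed

lemma finite_int_box [simp]: "finite (int_box n m)"
  unfolding int_box_eq_image by (intro finite_imageI finite_PiE) auto

lemma card_int_box: "card (int_box n m) = m ^ n"
proof -
  have "inj_on (\<lambda>g i. if i < n then g i else (0::int)) (PiE {..<n} (\<lambda>_. {0..<int m}))"
  proof (rule inj_onI)
    fix g h :: "nat \<Rightarrow> int"
    assume gh: "g \<in> PiE {..<n} (\<lambda>_. {0..<int m})" "h \<in> PiE {..<n} (\<lambda>_. {0..<int m})"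
      and eq: "(\<lambda>i. if i < n then g i else 0) = (\<lambda>i. if i < n then h i else 0)"
    show "g = h"
    proof (rule PiE_ext[OF gh])
      show "g i = h i" if "i \<in> {..<n}" for i
        using fun_cong[OF eq, of i] that by simp
    qed
  qed
  then show ?thesis
    by (simp add: int_box_eq_image card_image card_PiE)
qed

lemma sum_int_box_slice:
  fixes h :: "(nat \<Rightarrow> int) \<Rightarrow> real"
  assumes "i < n" "0 < m"
  shows "sum h (int_box n m) = (\<Sum>z\<in>{z\<in>int_box n m. z i = 0}. \<Sum>a<m. h (z(i := int a)))"
proof -
  have "sum h (int_box n m) = (\<Sum>(z, a)\<in>{z\<in>int_box n m. z i = 0} \<times> {..<m}. h (z(i := int a)))"
    by (rule sum.reindex_bij_witness[of _ "\<lambda>(z, a). z(i := int a)" "\<lambda>z. (z(i := 0), nat (z i))"])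
      (use assms in \<open>auto simp: int_box_def\<close>)
  then show ?thesis
    by (simp add: sum.cartesian_product)
qed

definition halves_sign :: "nat \<Rightarrow> int \<Rightarrow> real" where
  "halves_sign m a = (if a < int m then - 1 else 1)"

text \<open>Up to sign the discrete primitive of \<open>halves_sign\<close>. It vanishes at
  \<open>-1\<close> and at \<open>2 * m - 1\<close>, the last point of the box, so summation by
  parts has no boundary terms and a step leaving the box has weight 0.\<close>

definition tent :: "nat \<Rightarrow> int \<Rightarrow> real" where
  "tent m a = min (real_of_int a + 1) (2 * real m - 1 - real_of_int a)"

lemma tent_bounds: "a < 2 * int m \<Longrightarrow> 0 \<le> a \<Longrightarrow> 0 \<le> tent m a" "tent m a \<le> real m"
  by (auto simp: tent_def min_def)

lemma tent_diff: "tent m (a - 1) - tent m a = halves_sign m a"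
  by (auto simp: tent_def halves_sign_def min_def)

lemma sum_by_parts_tent:
  fixes g :: "int \<Rightarrow> real"
  shows "(\<Sum>a<2 * m. halves_sign m (int a) * g (int a)) =
    (\<Sum>a<2 * m. tent m (int a) * (g (int a + 1) - g (int a)))"
proof -
  have "(\<Sum>a<2 * m. tent m (int a) * (g (int a + 1) - g (int a)))
      - (\<Sum>a<2 * m. halves_sign m (int a) * g (int a))
    = (\<Sum>a<2 * m. tent m (int (Suc a) - 1) * g (int (Suc a)) - tent m (int a - 1) * g (int a))"
    unfolding sum_subtractf[symmetric] tent_diff[symmetric]
    by (rule sum.cong) (auto simp: algebra_simps)
  also have "\<dots> = 0"
    by (subst sum_lessThan_telescope) (auto simp: tent_def)
  finally show ?thesis
    by simp
qed

lemma sum_tent: "(\<Sum>a<2 * m. tent m (int a)) = (real m)\<^sup>2"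
proof -
  have "(\<Sum>a<2 * m. tent m (int a)) = (\<Sum>a<m. tent m (int a)) + (\<Sum>a\<in>{m..<2 * m}. tent m (int a))"
    by (subst sum.union_disjoint[symmetric]) (auto intro!: sum.cong)
  \<comment> \<open>Reflection pairs \<open>a < m\<close> with \<open>2 * m - 1 - a\<close>; their
    tents are \<open>a + 1\<close> and \<open>a\<close>, which leaves the sum of the first
    \<open>m\<close> odd numbers.\<close>
  also have "(\<Sum>a\<in>{m..<2 * m}. tent m (int a)) = (\<Sum>a<m. tent m (int (2 * m - 1 - a)))"
    by (rule sum.reindex_bij_witness[of _ "\<lambda>a. 2 * m - 1 - a" "\<lambda>a. 2 * m - 1 - a"]) auto
  also have "(\<Sum>a<m. tent m (int a)) + \<dots> = (\<Sum>a<m. 2 * real a + 1)"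
    unfolding sum.distrib[symmetric]
    by (rule sum.cong) (auto simp: tent_def of_nat_diff min_def)
  also have "\<dots> = (real m)\<^sup>2"
    by (induction m) (auto simp: power2_eq_square algebra_simps)
  finally show ?thesis .
qed

lemma sum_int_box_by_parts:
  fixes g :: "(nat \<Rightarrow> int) \<Rightarrow> real"
  assumes "i < n" "0 < m"
  shows "(\<Sum>z\<in>int_box n (2 * m). halves_sign m (z i) * g z) =
    (\<Sum>z\<in>int_box n (2 * m). tent m (z i) * (g (z(i := z i + 1)) - g z))"
proof -
  let ?S = "{z \<in> int_box n (2 * m). z i = 0}"
  have "(\<Sum>z\<in>int_box n (2 * m). halves_sign m (z i) * g z) =
      (\<Sum>z\<in>?S. \<Sum>a<2 * m. halves_sign m (int a) * g (z(i := int a)))"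
    using assms by (subst sum_int_box_slice[of i]) auto
  also have "\<dots> = (\<Sum>z\<in>?S. \<Sum>a<2 * m. tent m (int a) * (g (z(i := int a + 1)) - g (z(i := int a))))"
    by (rule sum.cong[OF refl], rule sum_by_parts_tent)
  also have "\<dots> = (\<Sum>z\<in>int_box n (2 * m). tent m (z i) * (g (z(i := z i + 1)) - g z))"
    using assms by (subst sum_int_box_slice[of i]) auto
  finally show ?thesis .
qed

lemma sum_int_box_tent:
  assumes "i < n" "0 < m"
  shows "(\<Sum>z\<in>int_box n (2 * m). tent m (z i)) = real (card (int_box n (2 * m))) * real m / 2"
proof -
  let ?S = "{z \<in> int_box n (2 * m). z i = 0}"
  have "real (card (int_box n (2 * m))) = real (card ?S) * (2 * real m)"
    using sum_int_box_slice[of i n "2 * m" "\<lambda>_. 1"] assms by simp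
  moreover have "(\<Sum>z\<in>int_box n (2 * m). tent m (z i)) = real (card ?S) * (real m)\<^sup>2"
    using assms by (subst sum_int_box_slice[of i]) (auto simp: sum_tent)
  ultimately show ?thesis
    by (simp add: power2_eq_square)
qed

text \<open>Sum by parts with \<open>G\<close> minus the identity. The identity has increment 1 in
  each direction and contributes the sum of the tents, on average \<open>m / 2\<close> per
  coordinate. This must be paid for by the sign-weighted error \<open>E\<close> or the increments
  \<open>W\<close>.\<close>

lemma box_increment_bound:
  fixes G :: "(nat \<Rightarrow> int) \<Rightarrow> nat \<Rightarrow> real"
  assumes "0 < m"
    and E: "\<And>z. z \<in> int_box n (2 * m) \<Longrightarrow>
      \<bar>\<Sum>i<n. halves_sign m (z i) * (G z i - real_of_int (z i))\<bar> \<le> E"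
    and W: "\<And>z. z \<in> int_box n (2 * m) \<Longrightarrow>
      (\<Sum>i<n. tent m (z i) * (G (z(i := z i + 1)) i - G z i)) \<le> W"
  shows "real n * real m / 2 \<le> E + W"
proof -
  let ?Q = "int_box n (2 * m)"
  let ?N = "real (card ?Q)"
  have "(\<Sum>z\<in>?Q. \<Sum>i<n. halves_sign m (z i) * (G z i - real_of_int (z i))) =
      (\<Sum>i<n. \<Sum>z\<in>?Q. halves_sign m (z i) * (G z i - real_of_int (z i)))"
    by (rule sum.swap)
  also have "\<dots> = (\<Sum>i<n. \<Sum>z\<in>?Q. tent m (z i) *
      ((G (z(i := z i + 1)) i - real_of_int ((z(i := z i + 1)) i)) - (G z i - real_of_int (z i))))"
    by (rule sum.cong[OF refl], rule sum_int_box_by_parts) (use \<open>0 < m\<close> in auto)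
  also have "\<dots> = (\<Sum>i<n. \<Sum>z\<in>?Q. tent m (z i) * (G (z(i := z i + 1)) i - G z i))
      - (\<Sum>i<n. \<Sum>z\<in>?Q. tent m (z i))"
    by (simp add: algebra_simps sum_subtractf sum.distrib)
  also have "(\<Sum>i<n. \<Sum>z\<in>?Q. tent m (z i)) = real n * (?N * real m / 2)"
    using \<open>0 < m\<close> by (simp add: sum_int_box_tent)
  also have "(\<Sum>i<n. \<Sum>z\<in>?Q. tent m (z i) * (G (z(i := z i + 1)) i - G z i)) =
      (\<Sum>z\<in>?Q. \<Sum>i<n. tent m (z i) * (G (z(i := z i + 1)) i - G z i))"
    by (rule sum.swap)
  also have "\<dots> \<le> ?N * W"
    by (rule sum_bounded_above) (rule W)
  finally have "(\<Sum>z\<in>?Q. \<Sum>i<n. halves_sign m (z i) * (G z i - real_of_int (z i)))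
      \<le> ?N * W - real n * (?N * real m / 2)"
    by simp
  moreover have "?N * (- E) \<le> (\<Sum>z\<in>?Q. \<Sum>i<n. halves_sign m (z i) * (G z i - real_of_int (z i)))"
  proof (rule sum_bounded_below)
    show "- E \<le> (\<Sum>i<n. halves_sign m (z i) * (G z i - real_of_int (z i)))" if "z \<in> ?Q" for z
      using E[OF that] by (simp only: abs_le_iff) linarith
  qed
  ultimately have "?N * (real n * real m / 2) \<le> ?N * (E + W)"
    by (simp add: algebra_simps)
  moreover have "0 < ?N"
    using \<open>0 < m\<close> by (simp add: card_int_box)
  ultimately show ?thesis
    by simp
qed

section \<open>Euclidean norm estimates\<close>

lemma sum_mult_le_L2_set:
  fixes x y :: "nat \<Rightarrow> real"
  shows "\<bar>\<Sum>i\<in>A. y i * x i\<bar> \<le> L2_set y A * L2_set x A"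
proof -
  have "\<bar>\<Sum>i\<in>A. y i * x i\<bar> \<le> (\<Sum>i\<in>A. \<bar>y i\<bar> * \<bar>x i\<bar>)"
    by (rule order_trans[OF sum_abs]) (simp add: abs_mult)
  also have "\<dots> \<le> L2_set y A * L2_set x A"
    by (rule L2_set_mult_ineq)
  finally show ?thesis .
qed

lemma L2_set_le_bound:
  assumes "\<And>i. i < n \<Longrightarrow> \<bar>y i\<bar> \<le> b" "0 \<le> b"
  shows "L2_set y {..<n} \<le> b * sqrt (real n)"
proof -
  have "(\<Sum>i<n. (y i)\<^sup>2) \<le> (\<Sum>i<n. b\<^sup>2)"
    by (rule sum_mono) (use assms in \<open>auto simp: abs_le_square_iff[symmetric]\<close>)
  then have "L2_set y {..<n} \<le> sqrt (b\<^sup>2 * real n)"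
    unfolding L2_set_def by (intro real_sqrt_le_mono) (simp add: mult.commute)
  then show ?thesis
    using \<open>0 \<le> b\<close> by (simp add: real_sqrt_mult)
qed

lemma L2_set_halves_sign: "L2_set (\<lambda>i. halves_sign m (z i)) {..<n} = sqrt (real n)"
proof -
  have "(halves_sign m a)\<^sup>2 = 1" for a
    by (simp add: halves_sign_def)
  then show ?thesis
    by (simp add: L2_set_def)
qed

section \<open>Separated subsets of the Hamming cube\<close>

text \<open>A point of \<open>Q\<close> at distance at least \<open>a\<close> from all of
  \<open>S\<close> could be added, so a maximal separated set is also a net.\<close>

lemma maximal_separated_subset:
  assumes "finite Q" and pos: "0 < a" and self: "\<And>x. d x x = (0::real)" and sym: "\<And>x y. d x y = d y x"
  shows "\<exists>S\<subseteq>Q. (\<forall>x\<in>S. \<forall>y\<in>S. x \<noteq> y \<longrightarrow> a \<le> d x y) \<and> (\<forall>x\<in>Q. \<exists>s\<in>S. d x s < a)"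
proof -
  define F where "F = {S. S \<subseteq> Q \<and> (\<forall>x\<in>S. \<forall>y\<in>S. x \<noteq> y \<longrightarrow> a \<le> d x y)}"
  have "finite F"
    using \<open>finite Q\<close> by (auto simp: F_def intro: finite_subset[of _ "Pow Q"])
  moreover have "F \<noteq> {}"
    by (auto simp: F_def)
  ultimately obtain S where S: "S \<in> F" and max: "\<forall>S'\<in>F. S \<subseteq> S' \<longrightarrow> S = S'"
    using finite_has_maximal[of F] by auto
  show ?thesis
  proof (intro exI[of _ S] conjI ballI)
    show "S \<subseteq> Q" "\<And>x y. x \<in> S \<Longrightarrow> y \<in> S \<Longrightarrow> x \<noteq> y \<longrightarrow> a \<le> d x y"
      using S by (simp_all add: F_def)
    show "\<exists>s\<in>S. d x s < a" if x: "x \<in> Q" for x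
    proof (rule ccontr)
      assume "\<not> (\<exists>s\<in>S. d x s < a)"
      then have far: "a \<le> d x s" if "s \<in> S" for s
        using that by force
      then have "insert x S \<in> F"
        using S x sym by (auto simp: F_def)
      then have "x \<in> S"
        using max by blast
      then show False
        using far[of x] self pos by simp
    qed
  qed
qed

lemma abs_diff_le_L2_set:
  fixes u v :: "nat \<Rightarrow> real"
  assumes "L2_set (\<lambda>i. u i - v i) {..<n} \<le> c" "i < n"
  shows "\<bar>u i - v i\<bar> \<le> c"
proof -
  have "\<bar>u i - v i\<bar> \<le> L2_set (\<lambda>i. \<bar>u i - v i\<bar>) {..<n}"
    using assms(2) by (intro member_le_L2_set) auto
  also have "\<dots> = L2_set (\<lambda>i. u i - v i) {..<n}"
    by (simp add: L2_set_def)
  finally show ?thesis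
    using assms(1) by linarith
qed

lemma L2_set_cube:
  assumes "x \<in> int_box n 2" "y \<in> int_box n 2"
  shows "L2_set (\<lambda>i. real_of_int (x i) - real_of_int (y i)) {..<n} = sqrt (ldist n x y)"
proof -
  have "(real_of_int (x i) - real_of_int (y i))\<^sup>2 = \<bar>real_of_int (x i - y i)\<bar>" if "i < n" for i
  proof -
    have "(x i = 0 \<or> x i = 1) \<and> (y i = 0 \<or> y i = 1)"
      using assms that by (force simp: int_box_def)
    then show ?thesis
      by auto
  qed
  then show ?thesis
    by (simp add: L2_set_def ldist_def)
qed

lemma ldist_increment: "i < M \<Longrightarrow> ldist M (z(i := z i + 1)) z = 1"
proof -
  assume "i < M"
  have "ldist M (z(i := z i + 1)) z = (\<Sum>k<M. if k = i then 1 else 0)"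
    unfolding ldist_def by (rule sum.cong) auto
  then show ?thesis
    using \<open>i < M\<close> by simp
qed

text \<open>The box inequality with \<open>m = 1\<close>, divided by \<open>n\<close>, becomes
  \<open>1 / 2 \<le> 2 * H + 1 / 8\<close>: one \<open>H\<close> comes from the unit steps, the
  other from the distance to the net.\<close>

lemma cube_extension_lower:
  assumes n: "1 \<le> n" and \<alpha>: "1 / 2 < \<alpha>" "\<alpha> \<le> 1" and Z: "contains_euclidean n Z"
  obtains S where "S \<noteq> {}" "finite S" "card S \<le> 2 ^ n"
    "ennreal (real n powr ((2 * \<alpha> - 1) / (4 * \<alpha>)) / 64) \<le> ext_modulus_from \<alpha> ell_infty S Z"
proof -
  \<comment> \<open>The power of \<open>n\<close> gives \<open>a powr \<alpha> \<le> sqrt n\<close>.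
    The divisor 64 gives \<open>sqrt a \<le> sqrt n / 8\<close>, small against the gain
    \<open>1 / 2\<close>.\<close>
  define a where "a = real n powr (1 / (2 * \<alpha>)) / 64"
  have a: "0 < a"
    using n by (simp add: a_def)
  let ?Q = "int_box n 2"
  obtain T where T: "T \<subseteq> ?Q" "\<forall>x\<in>T. \<forall>y\<in>T. x \<noteq> y \<longrightarrow> a \<le> ldist n x y"
    "\<forall>x\<in>?Q. \<exists>s\<in>T. ldist n x s < a"
    using maximal_separated_subset[where d = "ldist n", OF finite_int_box a ldist_self ldist_commute]
    by meson
  have "finite T" "card T \<le> 2 ^ n"
    using T(1) finite_subset[OF T(1)] card_mono[OF finite_int_box T(1)] by (auto simp: card_int_box)
  have "(\<lambda>_. 0) \<in> ?Q"
    by (simp add: int_box_def)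
  then have "T \<noteq> {}"
    using T(3) by blast
  define e1 where "e1 = (2 * \<alpha> - 1) / (4 * \<alpha>)"
  have e1: "e1 = 1 / (2 * \<alpha>) * (\<alpha> - 1 / 2)"
    using \<alpha> by (simp add: e1_def field_simps)
  define \<Lambda> where "\<Lambda> = a powr (1 / 2 - \<alpha>)"
  have \<Lambda>: "0 < \<Lambda>"
    using a by (simp add: \<Lambda>_def)
  \<comment> \<open>Distinct points of \<open>T\<close> have distance \<open>h \<ge> a\<close>, and
    there the decreasing function \<open>h powr (1 / 2 - \<alpha>)\<close> is at most its value at
    \<open>a\<close>.\<close>
  have sqrt_le: "sqrt h \<le> \<Lambda> * h powr \<alpha>" if "a \<le> h" for h
  proof -
    have "sqrt h = h powr (1 / 2 - \<alpha>) * h powr \<alpha>"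
      using that a by (simp add: powr_half_sqrt flip: powr_add)
    also have "\<dots> \<le> \<Lambda> * h powr \<alpha>"
      unfolding \<Lambda>_def using that a \<alpha> by (intro mult_right_mono powr_mono2') auto
    finally show ?thesis .
  qed
  have \<Lambda>_le: "real n powr e1 / 64 * \<Lambda> \<le> 1 / 8"
  proof -
    have "- e1 = 1 / (2 * \<alpha>) * (1 / 2 - \<alpha>)"
      unfolding e1 by (metis minus_diff_eq mult_minus_right)
    then have "\<Lambda> = real n powr (- e1) * (1 / 64) powr (1 / 2 - \<alpha>)"
      unfolding \<Lambda>_def a_def by (simp add: powr_divide powr_powr)
    also have "(1 / 64 :: real) powr (1 / 2 - \<alpha>) = 64 powr (\<alpha> - 1 / 2)"
      by (simp add: powr_divide flip: powr_minus_divide)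
    also have "(64::real) powr (\<alpha> - 1 / 2) \<le> 64 powr (1 / 2)"
      using \<alpha> by (intro powr_mono) auto
    also have "(64::real) powr (1 / 2) = 8"
      by (simp add: powr_half_sqrt real_sqrt_unique)
    finally have "\<Lambda> \<le> real n powr (- e1) * 8"
      using n by simp
    then have "real n powr e1 / 64 * \<Lambda> \<le> real n powr e1 / 64 * (real n powr (- e1) * 8)"
      by (intro mult_left_mono) auto
    then show ?thesis
      using n by (simp add: powr_minus)
  qed
  show thesis
  proof (rule ext_modulus_from_lower[where pos = "\<lambda>t. t" and \<phi> = "\<lambda>t i. real_of_int (t i)" and n = n
        and M = n and \<alpha> = \<alpha> and \<kappa> = "real n powr e1 / 64", OF Z \<open>finite T\<close> \<open>T \<noteq> {}\<close> \<Lambda>])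
    show "real_of_int (t i) = 0" if "t \<in> T" "n \<le> i" for t i
      using that T(1) by (auto simp: int_box_def)
    show "L2_set (\<lambda>i. real_of_int (s i) - real_of_int (t i)) {..<n} \<le> \<Lambda> * ldist n s t powr \<alpha>"
      if st: "s \<in> T" "t \<in> T" for s t
    proof (cases "s = t")
      case False
      then show ?thesis
        using L2_set_cube[OF subsetD[OF T(1) st(1)] subsetD[OF T(1) st(2)]] st T(2)
          sqrt_le[of "ldist n s t"] by auto
    qed (simp add: L2_set_def)
  next
    fix F :: "(nat \<Rightarrow> int) \<Rightarrow> nat \<Rightarrow> real" and H :: real
    assume H: "0 < H" and ext: "\<And>t i. t \<in> T \<Longrightarrow> i < n \<Longrightarrow> F t i = real_of_int (t i)"
      and F: "\<And>v w. L2_set (\<lambda>i. F v i - F w i) {..<n} \<le> H * ldist n v w powr \<alpha>"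
    have "real n * real 1 / 2 \<le> sqrt (real n) * (H * a powr \<alpha> + sqrt a) + real n * H"
    proof (rule box_increment_bound)
      fix z assume "z \<in> int_box n (2 * 1)"
      then have z: "z \<in> ?Q"
        by simp
      obtain s where s: "s \<in> T" "ldist n z s < a"
        using T(3) z by blast
      have "L2_set (\<lambda>i. F z i - real_of_int (z i)) {..<n} \<le>
          L2_set (\<lambda>i. F z i - F s i) {..<n} + L2_set (\<lambda>i. F s i - real_of_int (z i)) {..<n}"
        by (rule L2_set_diff_triangle)
      also have "L2_set (\<lambda>i. F s i - real_of_int (z i)) {..<n} = sqrt (ldist n s z)"
        using L2_set_cube[OF subsetD[OF T(1) s(1)] z] ext[OF s(1)] by (simp add: L2_set_def)
      also have "\<dots> \<le> sqrt a"
        using s by (simp add: ldist_commute)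
      also have "L2_set (\<lambda>i. F z i - F s i) {..<n} \<le> H * ldist n z s powr \<alpha>"
        by (rule F)
      also have "\<dots> \<le> H * a powr \<alpha>"
        using s H \<alpha> by (intro mult_left_mono powr_mono2) auto
      finally have "L2_set (\<lambda>i. F z i - real_of_int (z i)) {..<n} \<le> H * a powr \<alpha> + sqrt a"
        by simp
      then have "sqrt (real n) * L2_set (\<lambda>i. F z i - real_of_int (z i)) {..<n}
          \<le> sqrt (real n) * (H * a powr \<alpha> + sqrt a)"
        by (intro mult_left_mono) auto
      then show "\<bar>\<Sum>i<n. halves_sign 1 (z i) * (F z i - real_of_int (z i))\<bar>
          \<le> sqrt (real n) * (H * a powr \<alpha> + sqrt a)"
        using sum_mult_le_L2_set[where A = "{..<n}" and y = "\<lambda>i. halves_sign 1 (z i)"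
            and x = "\<lambda>i. F z i - real_of_int (z i)"]
        by (simp add: L2_set_halves_sign)
      have "tent 1 (z i) * (F (z(i := z i + 1)) i - F z i) \<le> H" if i: "i < n" for i
      proof -
        have "\<bar>F (z(i := z i + 1)) i - F z i\<bar> \<le> H"
          using abs_diff_le_L2_set[OF F i, of "z(i := z i + 1)" z] i by (simp add: ldist_increment)
        moreover have "tent 1 (z i) = 0 \<or> tent 1 (z i) = 1"
        proof -
          have "z i = 0 \<or> z i = 1"
            using z i by (force simp: int_box_def)
          then show ?thesis
            by (auto simp: tent_def)
        qed
        ultimately show ?thesis
          using H by auto
      qed
      then show "(\<Sum>i<n. tent 1 (z i) * (F (z(i := z i + 1)) i - F z i)) \<le> real n * H"
        using sum_bounded_above[of "{..<n}" "\<lambda>i. tent 1 (z i) * (F (z(i := z i + 1)) i - F z i)" H]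
        by simp
    qed simp
    moreover have "a powr \<alpha> \<le> sqrt (real n)"
    proof -
      have "a powr \<alpha> \<le> (real n powr (1 / (2 * \<alpha>))) powr \<alpha>"
        unfolding a_def using \<alpha> by (intro powr_mono2) auto
      also have "\<dots> = sqrt (real n)"
        using \<alpha> by (simp add: powr_powr powr_half_sqrt)
      finally show ?thesis .
    qed
    then have "sqrt (real n) * (H * a powr \<alpha>) \<le> sqrt (real n) * (H * sqrt (real n))"
      using H by (intro mult_left_mono) auto
    moreover have "sqrt a \<le> sqrt (real n) / 8"
    proof -
      have "real n powr (1 / (2 * \<alpha>)) \<le> real n powr 1"
        using n \<alpha> by (intro powr_mono) (auto simp: field_simps)
      then have "a \<le> real n / 64"
        using n by (simp add: a_def)
      then have "sqrt a \<le> sqrt (real n / 64)"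
        by simp
      also have "\<dots> = sqrt (real n) / 8"
        by (simp add: real_sqrt_divide real_sqrt_unique)
      finally show ?thesis .
    qed
    then have "sqrt (real n) * sqrt a \<le> sqrt (real n) * (sqrt (real n) / 8)"
      by (intro mult_left_mono) auto
    ultimately have "real n * (1 / 2) \<le> real n * (2 * H + 1 / 8)"
      by (simp add: algebra_simps)
    then have "1 / 2 \<le> 2 * H + 1 / 8"
      using n by (subst (asm) mult_le_cancel_left_pos) auto
    then show "real n powr e1 / 64 * \<Lambda> \<le> H"
      using \<Lambda>_le by linarith
  next
    fix S assume "S \<noteq> {}" "finite S" "card S \<le> card T"
      "ennreal (real n powr e1 / 64) \<le> ext_modulus_from \<alpha> ell_infty S Z"
    then show thesis
      using \<open>card T \<le> 2 ^ n\<close> by (intro that[of S]) (auto simp: e1_def)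
  qed
qed

section \<open>Sign matrices\<close>

text \<open>Expectation over independent uniform signs in the first \<open>n\<close> places, with 1
  elsewhere. Peeling off the last sign drives the inductions on moments.\<close>

fun sign_avg :: "nat \<Rightarrow> ((nat \<Rightarrow> int) \<Rightarrow> real) \<Rightarrow> real" where
  "sign_avg 0 \<phi> = \<phi> (\<lambda>_. 1)"
| "sign_avg (Suc n) \<phi> =
    (sign_avg n (\<lambda>b. \<phi> (b(n := 1))) + sign_avg n (\<lambda>b. \<phi> (b(n := - 1)))) / 2"

text \<open>The probabilistic method in its simplest form: at each place one of the two signs does
  no worse than the mean.\<close>

lemma sign_avg_attained: "\<exists>b. range b \<subseteq> {1, - 1} \<and> \<phi> b \<le> sign_avg n \<phi>"
proof (induction n arbitrary: \<phi>)
  case 0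
  then show ?case
    by (intro exI[of _ "\<lambda>_. 1"]) auto
next
  case (Suc n)
  obtain b where b: "range b \<subseteq> {1, - 1}" "\<phi> (b(n := 1)) \<le> sign_avg n (\<lambda>b. \<phi> (b(n := 1)))"
    using Suc[of "\<lambda>b. \<phi> (b(n := 1))"] by blast
  obtain c where c: "range c \<subseteq> {1, - 1}" "\<phi> (c(n := - 1)) \<le> sign_avg n (\<lambda>b. \<phi> (b(n := - 1)))"
    using Suc[of "\<lambda>b. \<phi> (b(n := - 1))"] by blast
  have "\<phi> (b(n := 1)) \<le> sign_avg (Suc n) \<phi> \<or> \<phi> (c(n := - 1)) \<le> sign_avg (Suc n) \<phi>"
    using b(2) c(2) by (auto simp: field_simps)
  moreover have "range (b(n := 1)) \<subseteq> {1, - 1}" "range (c(n := - 1)) \<subseteq> {1, - 1}"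
    using b(1) c(1) by (auto simp: image_subset_iff)
  ultimately show ?case
    by blast
qed

lemma sign_avg_mono: "(\<And>b. \<phi> b \<le> \<psi> b) \<Longrightarrow> sign_avg n \<phi> \<le> sign_avg n \<psi>"
  by (induction n arbitrary: \<phi> \<psi>) (auto intro!: add_mono divide_right_mono)

lemma sign_avg_add: "sign_avg n (\<lambda>b. \<phi> b + \<psi> b) = sign_avg n \<phi> + sign_avg n \<psi>"
  by (induction n arbitrary: \<phi> \<psi>) (auto simp: field_simps)

lemma sign_avg_cmult: "sign_avg n (\<lambda>b. c * \<phi> b) = c * sign_avg n \<phi>"
  by (induction n arbitrary: \<phi>) (auto simp: field_simps)

lemma sign_avg_const: "sign_avg n (\<lambda>b. c) = c"
  by (induction n) auto

lemma sign_avg_sum: "finite T \<Longrightarrow> sign_avg n (\<lambda>b. \<Sum>t\<in>T. \<phi> t b) = (\<Sum>t\<in>T. sign_avg n (\<phi> t))"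
  by (induction T rule: finite_induct) (auto simp: sign_avg_const sign_avg_add)

section \<open>Moments of random signed sums\<close>

lemma signed_sum_Suc:
  fixes b :: "nat \<Rightarrow> int" and z :: "nat \<Rightarrow> real"
  shows "x + (\<Sum>i<Suc n. real_of_int ((b(n := s)) i) * z i) =
    (x + real_of_int s * z n) + (\<Sum>i<n. real_of_int (b i) * z i)"
proof -
  have "(\<Sum>i<n. real_of_int ((b(n := s)) i) * z i) = (\<Sum>i<n. real_of_int (b i) * z i)"
    by (rule sum.cong) auto
  then show ?thesis
    by simp
qed

text \<open>The shift \<open>x\<close> makes the induction work: the last sign turns
  \<open>x\<close> into \<open>x + z n\<close> or \<open>x - z n\<close>.\<close>

lemma sign_avg_square:
  "sign_avg n (\<lambda>b. (x + (\<Sum>i<n. real_of_int (b i) * z i))\<^sup>2) = x\<^sup>2 + (\<Sum>i<n. (z i)\<^sup>2)"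
proof (induction n arbitrary: x)
  case (Suc n)
  show ?case
    by (simp only: sign_avg.simps signed_sum_Suc Suc) (simp add: power2_eq_square field_simps)
qed simp

text \<open>Khinchine's inequality for the fourth moment, with a shift for the induction; at
  \<open>x = 0\<close> it bounds the fourth moment by 3 times the square of the second.\<close>

lemma sign_avg_fourth:
  "sign_avg n (\<lambda>b. (x + (\<Sum>i<n. real_of_int (b i) * z i)) ^ 4)
    \<le> x ^ 4 + 6 * x\<^sup>2 * (\<Sum>i<n. (z i)\<^sup>2) + 3 * (\<Sum>i<n. (z i)\<^sup>2)\<^sup>2"
proof (induction n arbitrary: x)
  case (Suc n)
  let ?S = "\<Sum>i<n. (z i)\<^sup>2"
  have "sign_avg (Suc n) (\<lambda>b. (x + (\<Sum>i<Suc n. real_of_int (b i) * z i)) ^ 4) \<le>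
      (((x + z n) ^ 4 + 6 * (x + z n)\<^sup>2 * ?S + 3 * ?S\<^sup>2) +
       ((x - z n) ^ 4 + 6 * (x - z n)\<^sup>2 * ?S + 3 * ?S\<^sup>2)) / 2"
    unfolding sign_avg.simps signed_sum_Suc using Suc[of "x + z n"] Suc[of "x - z n"] by simp
  also have "\<dots> = x ^ 4 + 6 * x\<^sup>2 * (?S + (z n)\<^sup>2) + 3 * (?S + (z n)\<^sup>2)\<^sup>2 - 2 * ((z n)\<^sup>2)\<^sup>2"
    by (simp add: power2_eq_square power4_eq_xxxx field_simps)
  also have "\<dots> \<le> x ^ 4 + 6 * x\<^sup>2 * (?S + (z n)\<^sup>2) + 3 * (?S + (z n)\<^sup>2)\<^sup>2"
    by simp
  finally show ?case
    by simp
qed simp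

text \<open>An even quartic majorant, chosen so that the exponential moment is controlled by the
  second and fourth moments alone.\<close>

lemma exp_minus_half_abs_le:
  fixes x :: real
  shows "exp (- \<bar>x\<bar> / 2) \<le> 1 - 3 / 8 * x\<^sup>2 + 2 / 27 * x ^ 4"
proof -
  define u where "u = \<bar>x\<bar>"
  have u: "0 \<le> u" "x\<^sup>2 = u\<^sup>2" "x ^ 4 = u ^ 4"
    by (simp_all add: u_def power4_eq_xxxx power2_eq_square)
  have "1 + u / 2 + (u / 2)\<^sup>2 / 2 \<le> exp (u / 2)"
    using exp_lower_Taylor_quadratic[of "u / 2"] u by simp
  \<comment> \<open>With \<open>t = u / 2\<close> the product is \<open>1 + t^4 / 4\<close>, so a
    lower bound for \<open>exp t\<close> turns into an upper bound for
    \<open>exp (- t)\<close>.\<close>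
  moreover have "(1 - u / 2 + u\<^sup>2 / 8) * (1 + u / 2 + (u / 2)\<^sup>2 / 2) = 1 + (u\<^sup>2 / 8)\<^sup>2"
    by (simp add: power2_eq_square field_simps)
  then have "1 \<le> (1 - u / 2 + u\<^sup>2 / 8) * (1 + u / 2 + (u / 2)\<^sup>2 / 2)"
    by simp
  moreover have pos: "0 < 1 - u / 2 + u\<^sup>2 / 8"
  proof -
    have "1 - u / 2 + u\<^sup>2 / 8 = (1 - u / 4)\<^sup>2 + (u / 4)\<^sup>2"
      by (simp add: power2_eq_square field_simps)
    moreover have "1 - u / 4 \<noteq> 0 \<or> u / 4 \<noteq> 0"
      by auto
    ultimately show ?thesis
      by (metis sum_power2_gt_zero_iff)
  qed
  ultimately have "1 \<le> (1 - u / 2 + u\<^sup>2 / 8) * exp (u / 2)"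
    by (meson less_imp_le mult_left_mono order_trans)
  then have "exp (- u / 2) \<le> 1 - u / 2 + u\<^sup>2 / 8"
    by (simp add: exp_minus field_simps)
  also have "\<dots> \<le> 1 - 3 / 8 * u\<^sup>2 + 2 / 27 * u ^ 4"
  proof -
    \<comment> \<open>This trades the odd power \<open>u\<close> for even ones. The constant
      \<open>4 / 27\<close> is the least possible, with equality at
      \<open>u = 3 / 2\<close>.\<close>
    have "u - u\<^sup>2 + 4 / 27 * u ^ 4 = u * ((1 - 2 / 3 * u)\<^sup>2 * (1 + u / 3))"
      by (simp add: power2_eq_square power4_eq_xxxx field_simps)
    also have "\<dots> \<ge> 0"
      using u by simp
    finally show ?thesis
      by simp
  qed
  finally show ?thesis
    by (simp only: u(2,3) u_def[symmetric])
qed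

text \<open>After division by \<open>N\<close> the second moment is 1 and the fourth at most 3; then
  \<open>1 - 3 / 8 + 3 * 2 / 27 = 61 / 72\<close>.\<close>

lemma sign_avg_exp_le:
  assumes N: "0 < N" "(\<Sum>i<n. (z i)\<^sup>2) = N\<^sup>2"
  shows "sign_avg n (\<lambda>b. exp (- \<bar>\<Sum>i<n. real_of_int (b i) * z i\<bar> / (2 * N))) \<le> 61 / 72"
proof -
  let ?X = "\<lambda>b. \<Sum>i<n. real_of_int (b i) * z i"
  have "exp (- \<bar>?X b\<bar> / (2 * N)) \<le> 1 + ((- 3 / (8 * N\<^sup>2)) * (?X b)\<^sup>2 + 2 / (27 * N ^ 4) * (?X b) ^ 4)" for b
  proof -
    have "exp (- \<bar>?X b\<bar> / (2 * N)) = exp (- \<bar>?X b / N\<bar> / 2)"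
      using N by simp
    also have "\<dots> \<le> 1 - 3 / 8 * (?X b / N)\<^sup>2 + 2 / 27 * (?X b / N) ^ 4"
      by (rule exp_minus_half_abs_le)
    also have "\<dots> = 1 + ((- 3 / (8 * N\<^sup>2)) * (?X b)\<^sup>2 + 2 / (27 * N ^ 4) * (?X b) ^ 4)"
      by (simp add: power_divide)
    finally show ?thesis .
  qed
  then have "sign_avg n (\<lambda>b. exp (- \<bar>?X b\<bar> / (2 * N))) \<le>
      sign_avg n (\<lambda>b. 1 + ((- 3 / (8 * N\<^sup>2)) * (?X b)\<^sup>2 + 2 / (27 * N ^ 4) * (?X b) ^ 4))"
    by (rule sign_avg_mono)
  also have "\<dots> = 1 + ((- 3 / (8 * N\<^sup>2)) * sign_avg n (\<lambda>b. (?X b)\<^sup>2) + 2 / (27 * N ^ 4) * sign_avg n (\<lambda>b. (?X b) ^ 4))"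
    unfolding sign_avg_add sign_avg_cmult sign_avg_const ..
  also have "sign_avg n (\<lambda>b. (?X b)\<^sup>2) = N\<^sup>2"
    using sign_avg_square[of n 0 z] N by simp
  also have "2 / (27 * N ^ 4) * sign_avg n (\<lambda>b. (?X b) ^ 4) \<le> 2 / (27 * N ^ 4) * (3 * (N\<^sup>2)\<^sup>2)"
    using sign_avg_fourth[of n 0 z] N by (intro mult_left_mono) auto
  also have "\<dots> = 2 / 9"
    using N by (simp add: field_simps flip: power_mult)
  finally show ?thesis
    using N by (simp add: field_simps)
qed

text \<open>The rows are chosen one at a time, each no worse than the average over all sign vectors.\<close>

lemma sign_rows_potential:
  fixes z :: "'t \<Rightarrow> nat \<Rightarrow> real"
  assumes D: "finite D" and N: "\<And>x. x \<in> D \<Longrightarrow> 0 < N x"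
    "\<And>x. x \<in> D \<Longrightarrow> (\<Sum>i<n. (z x i)\<^sup>2) = (N x)\<^sup>2"
  shows "\<exists>B. (\<forall>k i. B k i \<in> {1, - 1 :: int}) \<and>
    (\<Sum>x\<in>D. exp (- (\<Sum>k<M. \<bar>\<Sum>i<n. real_of_int (B k i) * z x i\<bar>) / (2 * N x)))
      \<le> (61 / 72) ^ M * real (card D)"
proof (induction M)
  case 0
  show ?case
    by (intro exI[of _ "\<lambda>_ _. 1"]) simp
next
  case (Suc M)
  let ?X = "\<lambda>b x. \<bar>\<Sum>i<n. real_of_int (b i) * z x i\<bar>"
  obtain B where B: "\<forall>k i. B k i \<in> {1, - 1 :: int}"
    "(\<Sum>x\<in>D. exp (- (\<Sum>k<M. ?X (B k) x) / (2 * N x))) \<le> (61 / 72) ^ M * real (card D)"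
    using Suc by blast
  \<comment> \<open>Weights left by the rows chosen so far; a new row multiplies each by a factor of
    mean at most \<open>61 / 72\<close>.\<close>
  define c where "c x = exp (- (\<Sum>k<M. ?X (B k) x) / (2 * N x))" for x
  obtain b where b: "range b \<subseteq> {1, - 1 :: int}"
    "(\<Sum>x\<in>D. c x * exp (- ?X b x / (2 * N x)))
      \<le> sign_avg n (\<lambda>b. \<Sum>x\<in>D. c x * exp (- ?X b x / (2 * N x)))"
    using sign_avg_attained[where \<phi> = "\<lambda>b. \<Sum>x\<in>D. c x * exp (- ?X b x / (2 * N x))" and n = n]
    by (elim exE conjE) (rule that)
  have "sign_avg n (\<lambda>b. \<Sum>x\<in>D. c x * exp (- ?X b x / (2 * N x))) =
      (\<Sum>x\<in>D. c x * sign_avg n (\<lambda>b. exp (- ?X b x / (2 * N x))))"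
    by (simp only: sign_avg_sum[OF D] sign_avg_cmult)
  also have "\<dots> \<le> (\<Sum>x\<in>D. c x * (61 / 72))"
    using N by (intro sum_mono mult_left_mono sign_avg_exp_le) (auto simp: c_def)
  also have "\<dots> = 61 / 72 * (\<Sum>x\<in>D. c x)"
    by (metis mult.commute sum_distrib_right)
  also have "\<dots> \<le> 61 / 72 * ((61 / 72) ^ M * real (card D))"
    using B(2) by (intro mult_left_mono) (auto simp: c_def)
  finally have le: "(\<Sum>x\<in>D. c x * exp (- ?X b x / (2 * N x))) \<le> (61 / 72) ^ Suc M * real (card D)"
    using b(2) by simp
  have "exp (- (\<Sum>k<Suc M. ?X ((B(M := b)) k) x) / (2 * N x)) = c x * exp (- ?X b x / (2 * N x))" for x
  proof -
    have "(\<Sum>k<M. ?X ((B(M := b)) k) x) = (\<Sum>k<M. ?X (B k) x)"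
      by (rule sum.cong) auto
    then show ?thesis
      by (simp add: c_def add_divide_distrib diff_divide_distrib flip: exp_add)
  qed
  with le have "(\<Sum>x\<in>D. exp (- (\<Sum>k<Suc M. ?X ((B(M := b)) k) x) / (2 * N x)))
      \<le> (61 / 72) ^ Suc M * real (card D)"
    by simp
  moreover have "\<forall>k i. (B(M := b)) k i \<in> {1, - 1}"
    using B(1) b(1) by (auto simp: image_subset_iff)
  ultimately show ?case
    by (intro exI[of _ "B(M := b)"] conjI)
qed

text \<open>A union bound in exponential form: the total potential is at most
  \<open>exp (- M / 18)\<close>, hence so is each of its positive terms, and logarithms give the
  claim for every \<open>x\<close> in \<open>D\<close> at once.\<close>

lemma sign_matrix_exists:
  fixes z :: "'t \<Rightarrow> nat \<Rightarrow> real"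
  assumes D: "finite D" "real (card D) \<le> exp (7 * real M / 72)"
    and N: "\<And>x. x \<in> D \<Longrightarrow> 0 < L2_set (z x) {..<n}"
  obtains B where "\<forall>k i. B k i = 1 \<or> B k i = (- 1 :: int)"
    "\<forall>x\<in>D. real M / 9 * L2_set (z x) {..<n} \<le> (\<Sum>k<M. \<bar>\<Sum>i<n. real_of_int (B k i) * z x i\<bar>)"
proof -
  let ?N = "\<lambda>x. L2_set (z x) {..<n}"
  obtain B where B: "\<forall>k i. B k i \<in> {1, - 1 :: int}"
    "(\<Sum>x\<in>D. exp (- (\<Sum>k<M. \<bar>\<Sum>i<n. real_of_int (B k i) * z x i\<bar>) / (2 * ?N x)))
      \<le> (61 / 72) ^ M * real (card D)"
  proof -
    have "(\<Sum>i<n. (z x i)\<^sup>2) = (?N x)\<^sup>2" for x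
      by (simp add: L2_set_def sum_nonneg)
    then show ?thesis
      using sign_rows_potential[where N = ?N and z = z and n = n and M = M, OF D(1) N] that by blast
  qed
  \<comment> \<open>\<open>61 / 72 = 1 - 11 / 72\<close>. The cardinality of \<open>D\<close> may
    use up 7 of these 11 parts, which leaves \<open>4 / 72 = 1 / 18\<close>.\<close>
  have "(61 / 72) ^ M \<le> exp (- 11 / 72 :: real) ^ M"
    using exp_ge_add_one_self[of "- 11 / 72"] by (intro power_mono) auto
  also have "\<dots> = exp (- 11 * real M / 72)"
    by (simp flip: exp_of_nat_mult)
  finally have "(61 / 72) ^ M * real (card D) \<le> exp (- 11 * real M / 72) * exp (7 * real M / 72)"
    using D(2) by (intro mult_mono) auto
  also have "\<dots> = exp (- (real M / 18))"
    by (simp flip: exp_add)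
  finally have tot: "(61 / 72) ^ M * real (card D) \<le> exp (- (real M / 18))" .
  show thesis
  proof (rule that[of B]; intro allI ballI)
    show "B k i = 1 \<or> B k i = - 1" for k i
      using B(1) by auto
    fix x assume x: "x \<in> D"
    let ?s = "\<Sum>k<M. \<bar>\<Sum>i<n. real_of_int (B k i) * z x i\<bar>"
    have "exp (- ?s / (2 * ?N x)) \<le>
        (\<Sum>x\<in>D. exp (- (\<Sum>k<M. \<bar>\<Sum>i<n. real_of_int (B k i) * z x i\<bar>) / (2 * ?N x)))"
      by (rule member_le_sum[OF x]) (use D(1) in auto)
    also note B(2)
    also note tot
    finally have "exp (- ?s / (2 * ?N x)) \<le> exp (- (real M / 18))" .
    then have "real M / 18 \<le> ?s / (2 * ?N x)"
      by simp
    then show "real M / 9 * ?N x \<le> ?s"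
      using N[OF x] by (simp add: field_simps)
  qed
qed

section \<open>Averages over lattice cubes\<close>

definition line_avg :: "nat \<Rightarrow> nat \<Rightarrow> ((nat \<Rightarrow> int) \<Rightarrow> real) \<Rightarrow> (nat \<Rightarrow> int) \<Rightarrow> real" where
  "line_avg J k g v = (\<Sum>a<J. g (v(k := v k + int a))) / real J"

fun cube_avg :: "nat \<Rightarrow> nat \<Rightarrow> ((nat \<Rightarrow> int) \<Rightarrow> real) \<Rightarrow> (nat \<Rightarrow> int) \<Rightarrow> real" where
  "cube_avg J 0 g = g"
| "cube_avg J (Suc M) g = cube_avg J M (line_avg J M g)"

lemma line_avg_near:
  assumes "0 < J" "\<And>a. a < J \<Longrightarrow> \<bar>g (v(k := v k + int a)) - c\<bar> \<le> e"
  shows "\<bar>line_avg J k g v - c\<bar> \<le> e"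
proof -
  have "line_avg J k g v - c = (\<Sum>a<J. g (v(k := v k + int a)) - c) / real J"
    using \<open>0 < J\<close> by (simp add: line_avg_def sum_subtractf field_simps)
  moreover have "\<bar>\<Sum>a<J. g (v(k := v k + int a)) - c\<bar> \<le> (\<Sum>a<J. e)"
    by (rule order_trans[OF sum_abs sum_mono]) (use assms in auto)
  ultimately show ?thesis
    using \<open>0 < J\<close> by (simp add: abs_divide pos_divide_le_eq mult.commute)
qed

lemma line_avg_bound: "0 < J \<Longrightarrow> (\<And>v. \<bar>g v\<bar> \<le> c) \<Longrightarrow> \<bar>line_avg J k g v\<bar> \<le> c"
  using line_avg_near[of J g v k 0 c] by simp

lemma line_avg_commute: "line_avg J k (line_avg J j g) = line_avg J j (line_avg J k g)"
proof (cases "j = k")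
  case False
  have "(\<Sum>a<J. \<Sum>b<J. g (v(k := v k + int a, j := (v(k := v k + int a)) j + int b))) =
      (\<Sum>b<J. \<Sum>a<J. g (v(j := v j + int b, k := (v(j := v j + int b)) k + int a)))" for v
    using False by (subst sum.swap) (simp add: fun_upd_twist[of k j])
  then show ?thesis
    by (intro ext) (simp add: line_avg_def sum_divide_distrib[symmetric] del: fun_upd_apply)
qed simp

lemma line_avg_shift:
  "line_avg J k (\<lambda>u. g (\<lambda>i. u i + w i)) v = line_avg J k g (\<lambda>i. v i + w i)"
proof -
  have "(\<lambda>i. (v(k := v k + int a)) i + w i) = (\<lambda>i. v i + w i)(k := v k + w k + int a)" for a
    by auto
  then show ?thesis
    by (simp add: line_avg_def)
qed

lemma add_single: "(\<lambda>i. v i + ((\<lambda>_. 0)(j := s)) i) = v(j := v j + s :: int)"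
  by auto

lemma line_avg_shift_single:
  "line_avg J k (\<lambda>u. g (u(j := u j + s))) v = line_avg J k g (v(j := v j + s))"
  using line_avg_shift[of J k g "(\<lambda>_. 0)(j := s)" v] by (simp only: add_single)

lemma line_avg_sum:
  "line_avg J k (\<lambda>v. \<Sum>i\<in>A. y i * g i v) = (\<lambda>v. \<Sum>i\<in>A. y i * line_avg J k (g i) v)"
proof
  fix v
  have "(\<Sum>a<J. \<Sum>i\<in>A. y i * g i (v(k := v k + int a))) = (\<Sum>i\<in>A. y i * (\<Sum>a<J. g i (v(k := v k + int a))))"
    by (subst sum.swap) (simp add: sum_distrib_left)
  then show "line_avg J k (\<lambda>v. \<Sum>i\<in>A. y i * g i v) v = (\<Sum>i\<in>A. y i * line_avg J k (g i) v)"
    by (simp add: line_avg_def sum_divide_distrib[of _ A])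
qed

lemma line_avg_diff: "line_avg J k (\<lambda>v. g v - h v) = (\<lambda>v. line_avg J k g v - line_avg J k h v)"
  by (rule ext) (simp add: line_avg_def sum_subtractf diff_divide_distrib)

lemma cube_avg_shift:
  "cube_avg J M (\<lambda>u. g (\<lambda>i. u i + w i)) v = cube_avg J M g (\<lambda>i. v i + w i)"
proof (induction M arbitrary: g)
  case (Suc M)
  have "line_avg J M (\<lambda>u. g (\<lambda>i. u i + w i)) = (\<lambda>v. line_avg J M g (\<lambda>i. v i + w i))"
    by (rule ext) (rule line_avg_shift)
  then show ?case
    by (simp add: Suc)
qed simp

lemma cube_avg_shift_single:
  "cube_avg J M (\<lambda>u. g (u(j := u j + s))) v = cube_avg J M g (v(j := v j + s))"
  using cube_avg_shift[of J M g "(\<lambda>_. 0)(j := s)" v] by (simp only: add_single)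

lemma cube_avg_sum:
  "cube_avg J M (\<lambda>v. \<Sum>i\<in>A. y i * g i v) v = (\<Sum>i\<in>A. y i * cube_avg J M (g i) v)"
  by (induction M arbitrary: g) (simp_all add: line_avg_sum)

lemma cube_avg_diff: "cube_avg J M (\<lambda>v. g v - h v) v = cube_avg J M g v - cube_avg J M h v"
  by (induction M arbitrary: g h) (simp_all add: line_avg_diff)

lemma cube_avg_near:
  assumes "0 < J"
    and "\<And>w. (\<And>i. i < M \<Longrightarrow> \<bar>w i - v i\<bar> \<le> int J) \<Longrightarrow> (\<And>i. M \<le> i \<Longrightarrow> w i = v i) \<Longrightarrow> \<bar>g w - c\<bar> \<le> e"
  shows "\<bar>cube_avg J M g v - c\<bar> \<le> e"
  using assms(2)
proof (induction M arbitrary: g)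
  case (Suc M)
  have "\<bar>cube_avg J M (line_avg J M g) v - c\<bar> \<le> e"
  proof (rule Suc.IH)
    fix w assume w: "\<And>i. i < M \<Longrightarrow> \<bar>w i - v i\<bar> \<le> int J" "\<And>i. M \<le> i \<Longrightarrow> w i = v i"
    show "\<bar>line_avg J M g w - c\<bar> \<le> e"
      by (rule line_avg_near[OF \<open>0 < J\<close>], rule Suc.prems) (use w in \<open>auto simp: less_Suc_eq\<close>)
  qed
  then show ?case
    by simp
qed simp

lemma cube_avg_bound: "0 < J \<Longrightarrow> (\<And>v. \<bar>g v\<bar> \<le> c) \<Longrightarrow> \<bar>cube_avg J M g v\<bar> \<le> c"
  using cube_avg_near[of J M v g 0 c] by simp

text \<open>Line averages commute, so the one along \<open>k\<close> may be taken first, and the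
  others preserve a uniform bound.\<close>

lemma cube_avg_bound_line:
  assumes "0 < J" "k < M" "\<And>v. \<bar>line_avg J k g v\<bar> \<le> c"
  shows "\<bar>cube_avg J M g v\<bar> \<le> c"
  using assms(2,3)
proof (induction M arbitrary: g)
  case (Suc M)
  show ?case
  proof (cases "k = M")
    case True
    then show ?thesis
      using Suc.prems \<open>0 < J\<close> by (simp add: cube_avg_bound)
  next
    case False
    then show ?thesis
      using Suc \<open>0 < J\<close> by (simp add: line_avg_bound line_avg_commute[of J k M])
  qed
qed simp

lemma cube_avg_bound_plane:
  assumes "0 < J" "k < M" "j < M" "k \<noteq> j" "\<And>v. \<bar>line_avg J k (line_avg J j g) v\<bar> \<le> c"
  shows "\<bar>cube_avg J M g v\<bar> \<le> c"
  using assms(2-)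
proof (induction M arbitrary: g)
  case (Suc M)
  consider "k = M" "j < M" | "j = M" "k < M" | "k < M" "j < M"
    using Suc.prems by linarith
  then show ?case
  proof cases
    case 1
    then show ?thesis
      using Suc.prems \<open>0 < J\<close>
      by (simp add: line_avg_commute[of J M j] cube_avg_bound_line[of J j])
  next
    case 2
    then show ?thesis
      using Suc.prems \<open>0 < J\<close> by (simp add: cube_avg_bound_line[of J k])
  next
    case 3
    have "line_avg J k (line_avg J j (line_avg J M g)) = line_avg J M (line_avg J k (line_avg J j g))"
      by (metis line_avg_commute)
    with 3 show ?thesis
      using Suc.prems Suc.IH[of "line_avg J M g"] \<open>0 < J\<close> by (simp add: line_avg_bound)
  qed
qed simp

text \<open>Unit increments telescope along \<open>J\<close> consecutive points, leaving a
  difference of end points over \<open>J\<close>. For \<open>\<sigma> = - 1\<close> the segment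
  begins one point lower, whence \<open>min \<sigma> 0\<close>.\<close>

lemma line_avg_step:
  assumes \<sigma>: "\<sigma> = 1 \<or> \<sigma> = (- 1 :: int)"
  shows "line_avg J k (\<lambda>u. g (u(k := u k + \<sigma>)) - g u) v =
    real_of_int \<sigma> * (g (v(k := v k + (min \<sigma> 0 + int J))) - g (v(k := v k + min \<sigma> 0))) / real J"
  using \<sigma>
proof
  assume \<sigma>: "\<sigma> = 1"
  have "(\<Sum>a<J. g (v(k := v k + int a + 1)) - g (v(k := v k + int a))) =
      (\<Sum>a<J. g (v(k := v k + int (Suc a))) - g (v(k := v k + int a)))"
    by (intro sum.cong) (auto simp: algebra_simps)
  also have "\<dots> = g (v(k := v k + int J)) - g (v(k := v k + int 0))"
    by (rule sum_lessThan_telescope)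
  finally show ?thesis
    using \<sigma> by (simp add: line_avg_def)
next
  assume \<sigma>: "\<sigma> = - 1"
  have "(\<Sum>a<J. g (v(k := v k + int a + - 1)) - g (v(k := v k + int a))) =
      - (\<Sum>a<J. g (v(k := v k + (int (Suc a) - 1))) - g (v(k := v k + (int a - 1))))"
    unfolding sum_negf[symmetric] by (intro sum.cong) (auto simp: algebra_simps)
  also have "\<dots> = - (g (v(k := v k + (int J - 1))) - g (v(k := v k + (int 0 - 1))))"
    by (subst sum_lessThan_telescope) (rule refl)
  finally show ?thesis
    using \<sigma> by (simp add: line_avg_def algebra_simps)
qed

lemma ldist_single: "k < M \<Longrightarrow> ldist M (v(k := x)) (v(k := y)) = \<bar>real_of_int (x - y)\<bar>"
proof -
  assume "k < M"
  have "ldist M (v(k := x)) (v(k := y)) = (\<Sum>i<M. if i = k then \<bar>real_of_int (x - y)\<bar> else 0)"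
    unfolding ldist_def by (rule sum.cong) auto
  then show ?thesis
    using \<open>k < M\<close> by simp
qed

section \<open>Differences of averages of a Hoelder function\<close>

context
  fixes J M :: nat and g :: "(nat \<Rightarrow> int) \<Rightarrow> real" and \<eta> \<alpha> :: real
  assumes J: "0 < J"
    and g: "\<And>v w. \<bar>g v - g w\<bar> \<le> \<eta> * ldist M v w powr \<alpha>"
begin

lemma line_avg_increment_le:
  assumes "k < M" "\<sigma> = 1 \<or> \<sigma> = (- 1 :: int)"
  shows "\<bar>line_avg J k (\<lambda>u. g (u(k := u k + \<sigma>)) - g u) v\<bar> \<le> \<eta> * real J powr \<alpha> / real J"
proof -
  have "\<bar>real_of_int \<sigma>\<bar> = 1"
    using assms(2) by auto
  then show ?thesis
    using g[of "v(k := v k + (min \<sigma> 0 + int J))" "v(k := v k + min \<sigma> 0)"] J \<open>k < M\<close>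
    by (simp add: line_avg_step[OF assms(2)] ldist_single abs_mult divide_right_mono)
qed

lemma cube_avg_increment_le:
  assumes "k < M" "\<sigma> = 1 \<or> \<sigma> = (- 1 :: int)"
  shows "\<bar>cube_avg J M g (v(k := v k + \<sigma>)) - cube_avg J M g v\<bar> \<le> \<eta> * real J powr \<alpha> / real J"
  using cube_avg_bound_line[OF J \<open>k < M\<close> line_avg_increment_le[OF assms]]
  by (simp add: cube_avg_diff cube_avg_shift_single)

text \<open>Telescoping in two different directions gains \<open>1 / J\<close> twice; the factor 2
  is the triangle inequality for the second difference.\<close>

lemma cube_avg_second_difference_le:
  assumes "k < M" "j < M" "k \<noteq> j" and \<sigma>: "\<sigma> = 1 \<or> \<sigma> = (- 1 :: int)" and \<tau>: "\<tau> = 1 \<or> \<tau> = (- 1 :: int)"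
  shows "\<bar>(cube_avg J M g (v(j := v j + \<tau>, k := v k + \<sigma>)) - cube_avg J M g (v(j := v j + \<tau>)))
      - (cube_avg J M g (v(k := v k + \<sigma>)) - cube_avg J M g v)\<bar> \<le> 2 * \<eta> * real J powr \<alpha> / (real J)\<^sup>2"
proof -
  define f where "f u = g (u(k := u k + \<sigma>)) - g u" for u
  define c where "c = \<eta> * real J powr \<alpha> / real J"
  have f: "\<bar>line_avg J k f u\<bar> \<le> c" for u
    unfolding f_def c_def by (rule line_avg_increment_le) fact+
  have "\<bar>line_avg J k (line_avg J j (\<lambda>u. f (u(j := u j + \<tau>)) - f u)) u\<bar> \<le> 2 * c / real J" for u
  proof -
    have "line_avg J j (\<lambda>u. f (u(j := u j + \<tau>)) - f u) =
        (\<lambda>u. \<Sum>i\<in>{()}. (real_of_int \<tau> / real J) *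
          (f (u(j := u j + (min \<tau> 0 + int J))) - f (u(j := u j + min \<tau> 0))))"
      by (rule ext) (simp add: line_avg_step[OF \<tau>])
    then have "line_avg J k (line_avg J j (\<lambda>u. f (u(j := u j + \<tau>)) - f u)) u =
        (real_of_int \<tau> / real J) * (line_avg J k f (u(j := u j + (min \<tau> 0 + int J)))
          - line_avg J k f (u(j := u j + min \<tau> 0)))"
      by (simp only: line_avg_sum line_avg_diff line_avg_shift_single) simp
    moreover have "\<bar>real_of_int \<tau> / real J\<bar> = 1 / real J"
      using \<tau> by auto
    moreover have "\<bar>line_avg J k f (u(j := u j + (min \<tau> 0 + int J)))
          - line_avg J k f (u(j := u j + min \<tau> 0))\<bar> \<le> 2 * c"
      using f[of "u(j := u j + (min \<tau> 0 + int J))"] f[of "u(j := u j + min \<tau> 0)"] by linarith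
    ultimately show ?thesis
      using J by (simp only: abs_mult) (simp add: divide_right_mono)
  qed
  then have "\<bar>cube_avg J M (\<lambda>u. f (u(j := u j + \<tau>)) - f u) v\<bar> \<le> 2 * c / real J"
    by (rule cube_avg_bound_plane[OF J \<open>k < M\<close> \<open>j < M\<close> \<open>k \<noteq> j\<close>])
  moreover have "cube_avg J M (\<lambda>u. f (u(j := u j + \<tau>)) - f u) v =
      (cube_avg J M g (v(j := v j + \<tau>, k := v k + \<sigma>)) - cube_avg J M g (v(j := v j + \<tau>)))
      - (cube_avg J M g (v(k := v k + \<sigma>)) - cube_avg J M g v)"
  proof -
    have "cube_avg J M (\<lambda>u. f (u(j := u j + \<tau>)) - f u) v =
        cube_avg J M f (v(j := v j + \<tau>)) - cube_avg J M f v"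
      by (simp only: cube_avg_diff cube_avg_shift_single)
    moreover have "cube_avg J M f u = cube_avg J M g (u(k := u k + \<sigma>)) - cube_avg J M g u" for u
      unfolding f_def by (simp only: cube_avg_diff cube_avg_shift_single)
    ultimately show ?thesis
      using \<open>k \<noteq> j\<close> by simp
  qed
  ultimately show ?thesis
    by (simp add: c_def power2_eq_square mult.assoc)
qed

text \<open>The diagonal step is walked one axis at a time. The increment along \<open>k\<close> at
  the point then reached differs from the one at \<open>v\<close> by at most \<open>k\<close> second
  differences, which makes at most \<open>M\<close> squared of them in all.\<close>

lemma cube_avg_path_le:
  assumes b: "\<And>k. b k = 1 \<or> b k = (- 1 :: int)"
  shows "\<bar>cube_avg J M g (\<lambda>i. if i < M then v i + b i else v i) - cube_avg J M g v
      - (\<Sum>k<M. cube_avg J M g (v(k := v k + b k)) - cube_avg J M g v)\<bar>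
    \<le> (real M)\<^sup>2 * (2 * \<eta> * real J powr \<alpha> / (real J)\<^sup>2)"
proof -
  let ?A = "cube_avg J M g"
  define p where "p K i = (if i < K then v i + b i else v i)" for K i
  define c where "c = 2 * \<eta> * real J powr \<alpha> / (real J)\<^sup>2"
  have p_Suc: "p (Suc K) = (p K)(K := p K K + b K)" for K
    by (auto simp: p_def fun_eq_iff less_Suc_eq)
  have step: "\<bar>(?A ((p L)(k := v k + b k)) - ?A (p L)) - (?A (v(k := v k + b k)) - ?A v)\<bar> \<le> real L * c"
    if "L \<le> k" "k < M" for L k
    using that
  proof (induction L)
    case 0
    then show ?case
      by (simp add: p_def)
  next
    case (Suc L)
    have pLk: "p L k = v k"
      using Suc.prems by (simp add: p_def)
    have "\<bar>(?A ((p L)(L := p L L + b L, k := p L k + b k)) - ?A ((p L)(L := p L L + b L)))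
      - (?A ((p L)(k := p L k + b k)) - ?A (p L))\<bar> \<le> c"
      unfolding c_def using Suc.prems b by (intro cube_avg_second_difference_le) auto
    moreover have "\<bar>(?A ((p L)(k := v k + b k)) - ?A (p L)) - (?A (v(k := v k + b k)) - ?A v)\<bar> \<le> real L * c"
      by (rule Suc.IH) (use Suc.prems in auto)
    moreover have "real (Suc L) * c = real L * c + c"
      by (simp add: algebra_simps)
    ultimately show ?case
      unfolding p_Suc pLk by linarith
  qed
  have c: "real L * c \<le> real M * c" if "L < M" for L
  proof -
    have "0 \<le> c"
    proof -
      \<comment> \<open>Nonnegativity of \<open>\<eta>\<close> is read off from the Hoelder bound at
        two points at distance 1, which exist because \<open>0 < M\<close>.\<close>
      have "ldist M ((\<lambda>_. 0)(0 := 1)) ((\<lambda>_. 0)(0 := 0)) = 1"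
        using that by (subst ldist_single) auto
      then have "0 \<le> \<eta>"
        using order_trans[OF abs_ge_zero g] by (metis mult.right_neutral powr_one_eq_one)
      then show ?thesis
        by (simp add: c_def)
    qed
    then show ?thesis
      using that by (intro mult_right_mono) auto
  qed
  have "\<bar>?A (p K) - ?A v - (\<Sum>k<K. ?A (v(k := v k + b k)) - ?A v)\<bar> \<le> real K * (real M * c)" if "K \<le> M" for K
    using that
  proof (induction K)
    case 0
    then show ?case
      by (simp add: p_def)
  next
    case (Suc K)
    have pKK: "p K K = v K" and K: "K < M"
      using Suc.prems by (simp_all add: p_def)
    have "real (Suc K) * (real M * c) = real K * (real M * c) + real M * c"
      by (simp add: algebra_simps)
    moreover have "\<bar>?A (p K) - ?A v - (\<Sum>k<K. ?A (v(k := v k + b k)) - ?A v)\<bar> \<le> real K * (real M * c)"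
      by (rule Suc.IH) (use Suc.prems in auto)
    ultimately show ?case
      using step[OF order_refl K] c[OF K] unfolding p_Suc pKK sum.lessThan_Suc by linarith
  qed
  moreover have "p M = (\<lambda>i. if i < M then v i + b i else v i)"
    by (rule ext) (rule p_def)
  ultimately show ?thesis
    by (fastforce simp: c_def power2_eq_square mult.assoc)
qed

end

section \<open>Averages of vector-valued maps\<close>

definition vec_avg :: "nat \<Rightarrow> nat \<Rightarrow> ((nat \<Rightarrow> int) \<Rightarrow> nat \<Rightarrow> real) \<Rightarrow> (nat \<Rightarrow> int) \<Rightarrow> nat \<Rightarrow> real" where
  "vec_avg J M F v i = cube_avg J M (\<lambda>u. F u i) v"

context
  fixes F :: "(nat \<Rightarrow> int) \<Rightarrow> nat \<Rightarrow> real" and H \<alpha> :: real and n J M :: nat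
  assumes J: "0 < J" and \<alpha>: "0 \<le> \<alpha>"
    and F: "\<And>v w. L2_set (\<lambda>i. F v i - F w i) {..<n} \<le> H * ldist M v w powr \<alpha>"
begin

text \<open>By Cauchy-Schwarz, pairing with a fixed vector \<open>y\<close> gives a scalar Hoelder
  function, so the scalar estimates apply at the price of the norm of \<open>y\<close> instead of a
  sum over coordinates.\<close>

lemma test_holder:
  "\<bar>(\<Sum>i<n. y i * F v i) - (\<Sum>i<n. y i * F w i)\<bar> \<le> L2_set y {..<n} * H * ldist M v w powr \<alpha>"
proof -
  have "\<bar>\<Sum>i<n. y i * (F v i - F w i)\<bar> \<le> L2_set y {..<n} * L2_set (\<lambda>i. F v i - F w i) {..<n}"
    by (rule sum_mult_le_L2_set)
  also have "\<dots> \<le> L2_set y {..<n} * (H * ldist M v w powr \<alpha>)"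
    using F by (intro mult_left_mono) auto
  finally show ?thesis
    by (simp add: sum_subtractf right_diff_distrib mult.assoc)
qed

lemma vec_avg_test: "(\<Sum>i<n. y i * vec_avg J M F v i) = cube_avg J M (\<lambda>u. \<Sum>i<n. y i * F u i) v"
  by (simp add: vec_avg_def cube_avg_sum)

lemma vec_avg_increment_le:
  assumes "k < M" "\<sigma> = 1 \<or> \<sigma> = (- 1 :: int)"
  shows "(\<Sum>i<n. y i * (vec_avg J M F (v(k := v k + \<sigma>)) i - vec_avg J M F v i))
    \<le> L2_set y {..<n} * H * real J powr \<alpha> / real J"
  using cube_avg_increment_le[OF J test_holder[where y = y] assms, of v] vec_avg_test[of y]
  by (simp add: right_diff_distrib sum_subtractf abs_le_iff)

text \<open>Every point of the averaging cube is within \<open>\<ell>\<^sub>1\<close> distance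
  \<open>M * J\<close> of \<open>v\<close>.\<close>

lemma vec_avg_near:
  assumes "0 \<le> H"
  shows "\<bar>\<Sum>i<n. y i * (vec_avg J M F v i - F v i)\<bar> \<le> L2_set y {..<n} * H * (real M * real J) powr \<alpha>"
proof -
  have "\<bar>cube_avg J M (\<lambda>u. \<Sum>i<n. y i * F u i) v - (\<Sum>i<n. y i * F v i)\<bar>
      \<le> L2_set y {..<n} * H * (real M * real J) powr \<alpha>"
  proof (rule cube_avg_near[OF J])
    fix w assume w: "\<And>i. i < M \<Longrightarrow> \<bar>w i - v i\<bar> \<le> int J"
    have "ldist M w v \<le> (\<Sum>k<M. real J)"
      unfolding ldist_def
    proof (rule sum_mono)
      show "\<bar>real_of_int (w k - v k)\<bar> \<le> real J" if "k \<in> {..<M}" for k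
      proof -
        have "\<bar>w k - v k\<bar> \<le> int J"
          using w[of k] that by simp
        then show ?thesis
          by linarith
      qed
    qed
    then have "ldist M w v powr \<alpha> \<le> (real M * real J) powr \<alpha>"
      using \<alpha> by (intro powr_mono2) auto
    then have "L2_set y {..<n} * H * ldist M w v powr \<alpha> \<le> L2_set y {..<n} * H * (real M * real J) powr \<alpha>"
      using assms by (intro mult_left_mono) auto
    with test_holder[of y w v]
    show "\<bar>(\<Sum>i<n. y i * F w i) - (\<Sum>i<n. y i * F v i)\<bar> \<le> L2_set y {..<n} * H * (real M * real J) powr \<alpha>"
      by linarith
  qed
  then show ?thesis
    by (simp add: right_diff_distrib sum_subtractf flip: vec_avg_test)
qed

lemma vec_avg_path_le:
  assumes "i < n" and b: "\<And>k. b k = 1 \<or> b k = (- 1 :: int)"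
  shows "vec_avg J M F (\<lambda>k. if k < M then v k + b k else v k) i - vec_avg J M F v i
    \<le> (\<Sum>k<M. vec_avg J M F (v(k := v k + b k)) i - vec_avg J M F v i)
      + (real M)\<^sup>2 * (2 * H * real J powr \<alpha> / (real J)\<^sup>2)"
proof -
  have "\<bar>F v i - F w i\<bar> \<le> H * ldist M v w powr \<alpha>" for v w
    by (rule abs_diff_le_L2_set[OF F \<open>i < n\<close>])
  from cube_avg_path_le[where b = b and v = v, OF J this b] show ?thesis
    unfolding vec_avg_def by linarith
qed

text \<open>Grouping the coordinates \<open>i\<close> by the sign of \<open>B k i\<close> costs a factor 2 but tests the
  increment along the axis \<open>k\<close> against a single vector; this saves \<open>sqrt n\<close> over coordinatewise bounds.\<close>

lemma vec_avg_sign_increment_le: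
  assumes H: "0 \<le> H" and B: "\<And>k i. B k i = 1 \<or> B k i = (- 1 :: int)"
    and c: "0 \<le> c" and \<tau>: "\<And>i. i < n \<Longrightarrow> 0 \<le> \<tau> i \<and> \<tau> i \<le> c"
  shows "(\<Sum>i<n. \<tau> i * (vec_avg J M F (\<lambda>k. if k < M then v k + B k i else v k) i - vec_avg J M F v i))
    \<le> 2 * real M * c * sqrt (real n) * H * real J powr \<alpha> / real J
      + real n * c * ((real M)\<^sup>2 * (2 * H * real J powr \<alpha> / (real J)\<^sup>2))"
proof -
  let ?G = "vec_avg J M F"
  let ?e = "(real M)\<^sup>2 * (2 * H * real J powr \<alpha> / (real J)\<^sup>2)"
  have e: "0 \<le> ?e"
    using H by simp
  have single: "(\<Sum>i<n. \<tau> i * (?G (v(k := v k + B k i)) i - ?G v i))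
      \<le> 2 * (c * sqrt (real n) * H * real J powr \<alpha> / real J)" if k: "k < M" for k
  proof -
    define y where "y \<sigma> i = (if B k i = \<sigma> then \<tau> i else 0)" for \<sigma> i
    have "L2_set (y \<sigma>) {..<n} \<le> c * sqrt (real n)" for \<sigma>
      by (rule L2_set_le_bound) (use c \<tau> in \<open>auto simp: y_def\<close>)
    then have y: "(\<Sum>i<n. y \<sigma> i * (?G (v(k := v k + \<sigma>)) i - ?G v i))
        \<le> c * sqrt (real n) * H * real J powr \<alpha> / real J" if "\<sigma> = 1 \<or> \<sigma> = - 1" for \<sigma>
      using order_trans[OF vec_avg_increment_le[OF k that, of "y \<sigma>" v]] H
      by (simp add: divide_right_mono mult_right_mono)
    have "(\<Sum>i<n. \<tau> i * (?G (v(k := v k + B k i)) i - ?G v i)) =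
        (\<Sum>i<n. y 1 i * (?G (v(k := v k + 1)) i - ?G v i)) + (\<Sum>i<n. y (- 1) i * (?G (v(k := v k + - 1)) i - ?G v i))"
      unfolding sum.distrib[symmetric]
    proof (rule sum.cong[OF refl])
      show "\<tau> i * (?G (v(k := v k + B k i)) i - ?G v i) =
          y 1 i * (?G (v(k := v k + 1)) i - ?G v i) + y (- 1) i * (?G (v(k := v k + - 1)) i - ?G v i)" for i
        using B[of k i] by (elim disjE) (simp_all add: y_def)
    qed
    also have "\<dots> \<le> c * sqrt (real n) * H * real J powr \<alpha> / real J + c * sqrt (real n) * H * real J powr \<alpha> / real J"
      by (intro add_mono y) auto
    finally show ?thesis
      by (simp only: mult_2)
  qed
  have "(\<Sum>i<n. \<tau> i * (?G (\<lambda>k. if k < M then v k + B k i else v k) i - ?G v i))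
      \<le> (\<Sum>i<n. \<tau> i * (\<Sum>k<M. ?G (v(k := v k + B k i)) i - ?G v i) + c * ?e)"
  proof (rule sum_mono)
    fix i assume "i \<in> {..<n}"
    then have i: "i < n"
      by simp
    have "\<tau> i * (?G (\<lambda>k. if k < M then v k + B k i else v k) i - ?G v i)
        \<le> \<tau> i * ((\<Sum>k<M. ?G (v(k := v k + B k i)) i - ?G v i) + ?e)"
      using \<tau>[OF i] B by (intro mult_left_mono vec_avg_path_le i) auto
    also have "\<dots> \<le> \<tau> i * (\<Sum>k<M. ?G (v(k := v k + B k i)) i - ?G v i) + c * ?e"
      unfolding distrib_left using \<tau>[OF i] e by (intro add_left_mono mult_right_mono) auto
    finally show "\<tau> i * (?G (\<lambda>k. if k < M then v k + B k i else v k) i - ?G v i)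
        \<le> \<tau> i * (\<Sum>k<M. ?G (v(k := v k + B k i)) i - ?G v i) + c * ?e" .
  qed
  also have "\<dots> = (\<Sum>k<M. \<Sum>i<n. \<tau> i * (?G (v(k := v k + B k i)) i - ?G v i)) + real n * (c * ?e)"
  proof -
    have "(\<Sum>k<M. \<Sum>i<n. \<tau> i * (?G (v(k := v k + B k i)) i - ?G v i)) =
        (\<Sum>i<n. \<tau> i * (\<Sum>k<M. ?G (v(k := v k + B k i)) i - ?G v i))"
      by (subst sum.swap) (simp only: sum_distrib_left)
    then show ?thesis
      by (simp only: sum.distrib sum_constant card_lessThan)
  qed
  also have "(\<Sum>k<M. \<Sum>i<n. \<tau> i * (?G (v(k := v k + B k i)) i - ?G v i))
      \<le> (\<Sum>k<M. 2 * (c * sqrt (real n) * H * real J powr \<alpha> / real J))"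
    by (rule sum_mono) (use single in auto)
  finally show ?thesis
    by (simp add: algebra_simps)
qed

end

section \<open>The image of the grid under the sign matrix\<close>

definition sign_image :: "nat \<Rightarrow> nat \<Rightarrow> (nat \<Rightarrow> nat \<Rightarrow> int) \<Rightarrow> (nat \<Rightarrow> int) \<Rightarrow> nat \<Rightarrow> int" where
  "sign_image n M B z k = (if k < M then \<Sum>i<n. B k i * z i else 0)"

text \<open>Moving \<open>z\<close> by a unit vector adds a column of signs, that is, a diagonal
  step in the form treated by \<open>vec_avg_path_le\<close>.\<close>

lemma sign_image_increment:
  assumes "i < n"
  shows "sign_image n M B (z(i := z i + 1)) =
    (\<lambda>k. if k < M then sign_image n M B z k + B k i else sign_image n M B z k)"
proof
  fix k
  have "(\<Sum>j<n. B k j * (z(i := z i + 1)) j) = (\<Sum>j<n. B k j * z j + (if j = i then B k i else 0))"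
    by (rule sum.cong) (auto simp: algebra_simps)
  also have "\<dots> = (\<Sum>j<n. B k j * z j) + B k i"
    using assms by (simp add: sum.distrib)
  finally show "sign_image n M B (z(i := z i + 1)) k =
      (if k < M then sign_image n M B z k + B k i else sign_image n M B z k)"
    by (simp add: sign_image_def)
qed

lemma ldist_sign_image:
  "ldist M (sign_image n M B x) (sign_image n M B y) =
    (\<Sum>k<M. \<bar>\<Sum>i<n. real_of_int (B k i) * (real_of_int (x i) - real_of_int (y i))\<bar>)"
  unfolding ldist_def
  by (rule sum.cong) (auto simp: sign_image_def right_diff_distrib sum_subtractf)

text \<open>\<open>F\<close> inverts the sign matrix on the grid, so the averaged map differs from
  the identity only by the displacement due to averaging. The lower bound on \<open>J\<close> lets
  the first-order term absorb the second differences.\<close>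

lemma grid_increment_bound:
  assumes "1 \<le> n" "1 \<le> m" "0 < J" "real M * sqrt (real n) \<le> real J" "0 \<le> \<alpha>" "0 \<le> H"
    and B: "\<And>k i. B k i = 1 \<or> B k i = (- 1 :: int)"
    and F: "\<And>v w. L2_set (\<lambda>i. F v i - F w i) {..<n} \<le> H * ldist M v w powr \<alpha>"
    and ext: "\<And>z i. z \<in> int_box n (2 * m) \<Longrightarrow> i < n \<Longrightarrow> F (sign_image n M B z) i = real_of_int (z i)"
  shows "real n * real m / 2 \<le> sqrt (real n) * H * (real M * real J) powr \<alpha>
    + 4 * real M * real m * sqrt (real n) * H * real J powr \<alpha> / real J"
proof (rule box_increment_bound[where G = "\<lambda>z. vec_avg J M F (sign_image n M B z)"])
  fix z assume z: "z \<in> int_box n (2 * m)"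
  let ?v = "sign_image n M B z"
  have "(\<Sum>i<n. halves_sign m (z i) * (vec_avg J M F ?v i - real_of_int (z i))) =
      (\<Sum>i<n. halves_sign m (z i) * (vec_avg J M F ?v i - F ?v i))"
    by (rule sum.cong) (use ext[OF z] in auto)
  then show "\<bar>\<Sum>i<n. halves_sign m (z i) * (vec_avg J M F ?v i - real_of_int (z i))\<bar>
      \<le> sqrt (real n) * H * (real M * real J) powr \<alpha>"
    using vec_avg_near[OF \<open>0 < J\<close> \<open>0 \<le> \<alpha>\<close> F \<open>0 \<le> H\<close>, of "\<lambda>i. halves_sign m (z i)" ?v]
    by (simp add: L2_set_halves_sign)
  have "(\<Sum>i<n. tent m (z i) * (vec_avg J M F (sign_image n M B (z(i := z i + 1))) i - vec_avg J M F ?v i))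
      = (\<Sum>i<n. tent m (z i) * (vec_avg J M F (\<lambda>k. if k < M then ?v k + B k i else ?v k) i - vec_avg J M F ?v i))"
    by (rule sum.cong) (auto simp: sign_image_increment)
  also have "\<dots> \<le> 2 * real M * real m * sqrt (real n) * H * real J powr \<alpha> / real J
      + real n * real m * ((real M)\<^sup>2 * (2 * H * real J powr \<alpha> / (real J)\<^sup>2))"
  proof (rule vec_avg_sign_increment_le[OF \<open>0 < J\<close> \<open>0 \<le> \<alpha>\<close> F \<open>0 \<le> H\<close> B])
    show "0 \<le> tent m (z i) \<and> tent m (z i) \<le> real m" if "i < n" for i
      using tent_bounds[where a = "z i" and m = m] z that by (auto simp: int_box_def)
  qed simp
  \<comment> \<open>The second-order term is the first-order one times
    \<open>M * sqrt n / J\<close>, a factor at most 1; so the constant 2 becomes 4.\<close>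
  also have "real n * real m * ((real M)\<^sup>2 * (2 * H * real J powr \<alpha> / (real J)\<^sup>2)) =
      (2 * real M * real m * sqrt (real n) * H * real J powr \<alpha> / real J) * (real M * sqrt (real n) / real J)"
    using \<open>0 < J\<close> by (simp add: field_simps power2_eq_square)
  also have "2 * real M * real m * sqrt (real n) * H * real J powr \<alpha> / real J
      + (2 * real M * real m * sqrt (real n) * H * real J powr \<alpha> / real J) * (real M * sqrt (real n) / real J)
    \<le> 2 * real M * real m * sqrt (real n) * H * real J powr \<alpha> / real J
      + (2 * real M * real m * sqrt (real n) * H * real J powr \<alpha> / real J) * 1"
    using assms(3-6) by (intro add_left_mono mult_left_mono) auto
  also have "\<dots> = 4 * real M * real m * sqrt (real n) * H * real J powr \<alpha> / real J"
    by simp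
  finally show "(\<Sum>i<n. tent m (z i) * (vec_avg J M F (sign_image n M B (z(i := z i + 1))) i - vec_avg J M F ?v i))
      \<le> 4 * real M * real m * sqrt (real n) * H * real J powr \<alpha> / real J"
    .
qed (use assms in auto)

section \<open>The lower bound from a Euclidean grid\<close>

text \<open>The last bound makes the number of pairs of grid points admissible for
  \<open>sign_matrix_exists\<close>. The choice \<open>m = M * n\<close> later ensures
  \<open>M * sqrt n \<le> J\<close>.\<close>

lemma sign_matrix_parameters:
  assumes "1 \<le> (n::nat)"
  obtains M m :: nat where "real M \<le> 800 * real n powr (3 / 2)" "m = M * n" "1 \<le> M"
    "2 * real m \<le> 1600 * real n ^ 3" "((2 * real m)\<^sup>2) ^ n \<le> exp (7 * real M / 72)"
proof -
  define r where "r = nat \<lceil>sqrt (real n)\<rceil>"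
  have n1: "1 \<le> sqrt (real n)"
    using assms by simp
  then have r: "sqrt (real n) \<le> real r" "real r \<le> 2 * sqrt (real n)"
    unfolding r_def by linarith+
  have n2: "sqrt (real n) \<le> real n"
    using n1 mult_left_mono[OF n1, of "sqrt (real n)"] by simp
  define L M m where "L = 400 * r" and "M = n * L" and "m = M * n"
  show thesis
  proof (rule that[of M m])
    show "real M \<le> 800 * real n powr (3 / 2)"
    proof -
      have "real n powr (3 / 2) = real n powr (1 + 1 / 2)"
        by simp
      also have "\<dots> = real n * sqrt (real n)"
        using assms by (simp only: powr_add) (simp add: powr_half_sqrt)
      finally show ?thesis
        using mult_left_mono[OF r(2), of "400 * real n"] by (simp add: M_def L_def)
    qed
    show "1 \<le> M"
      using assms r n1 by (auto simp: M_def L_def Suc_le_eq intro!: Nat.gr0I)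
    have r': "real r \<le> 2 * real n"
      using r n2 by linarith
    show "2 * real m \<le> 1600 * real n ^ 3"
      using mult_left_mono[OF r', of "800 * (real n)\<^sup>2"]
      by (simp add: m_def M_def L_def power2_eq_square power3_eq_cube)
    have "real n \<le> (real r)\<^sup>2"
      using power_mono[OF r(1), of 2] by simp
    then have "(real n)\<^sup>2 \<le> ((real r)\<^sup>2)\<^sup>2"
      by (intro power_mono) auto
    then have "2 * real m \<le> 800 * real r ^ 5"
      using mult_right_mono[of "(real n)\<^sup>2" "((real r)\<^sup>2)\<^sup>2" "800 * real r"]
      by (simp add: m_def M_def L_def power2_eq_square eval_nat_numeral mult_ac)
    then have "(2 * real m)\<^sup>2 \<le> (800 * real r ^ 5)\<^sup>2"
      by (intro power_mono) auto
    also have "\<dots> = 640000 * real r ^ 10"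
      by (simp add: power_mult_distrib flip: power_mult)
    \<comment> \<open>The 400 in \<open>L\<close> is large enough that
      \<open>(7 * 400 / 720) ^ 10 = (35 / 9) ^ 10\<close> exceeds 640000; the tenth power matches
      the degree in \<open>r\<close>.\<close>
    also have "\<dots> \<le> (35 / 9) ^ 10 * real r ^ 10"
      by (intro mult_right_mono) (auto simp: power_divide)
    also have "\<dots> = (7 * real L / 720) ^ 10"
      by (simp add: L_def power_mult_distrib[symmetric])
    also have "\<dots> \<le> exp (7 * real L / 720) ^ 10"
      using exp_ge_add_one_self[of "7 * real L / 720"] by (intro power_mono) linarith+
    also have "\<dots> = exp (7 * real L / 72)"
      by (simp flip: exp_of_nat_mult)
    finally have "((2 * real m)\<^sup>2) ^ n \<le> exp (7 * real L / 72) ^ n"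
      by (intro power_mono) auto
    then show "((2 * real m)\<^sup>2) ^ n \<le> exp (7 * real M / 72)"
      by (simp add: M_def mult_ac flip: exp_of_nat_mult)
  qed (simp add: m_def)
qed

text \<open>Logarithmic form of the final comparison, with \<open>a\<close>, \<open>\<mu>\<close>,
  \<open>l\<close> standing for \<open>ln n\<close>, \<open>ln m\<close>, \<open>ln M\<close>. The
  terms in \<open>\<mu>\<close> cancel; inserting the bound on \<open>l\<close> leaves
  \<open>- (1 - \<alpha>)^2 * a / 2\<close>, and \<open>172800 = 2 * 9 * 12 * 800\<close> absorbs
  the constants.\<close>

lemma grid_exponent_bound:
  fixes a \<mu> l \<alpha> :: real
  assumes \<alpha>: "1 / 2 < \<alpha>" "\<alpha> \<le> 1" and a: "0 \<le> a" and l: "l \<le> ln 800 + 3 / 2 * a"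
  shows "(\<alpha>\<^sup>2 - 1 / 2) * a - ln 172800 + (1 - \<alpha>) * (ln 2 + \<mu> + a / 2) + \<alpha> * (ln 9 - l)
    + ln 12 + \<alpha> * \<mu> + (2 * \<alpha> - \<alpha>\<^sup>2) * l \<le> a / 2 + \<mu>"
proof -
  have c: "0 \<le> \<alpha> - \<alpha>\<^sup>2" "\<alpha> - \<alpha>\<^sup>2 \<le> 1"
    using \<alpha> mult_left_mono[of \<alpha> 1 \<alpha>] zero_le_power2[of \<alpha>]
    by (simp add: power2_eq_square, linarith)
  have "(\<alpha> - \<alpha>\<^sup>2) * l \<le> (\<alpha> - \<alpha>\<^sup>2) * (ln 800 + 3 / 2 * a)"
    using l c(1) by (rule mult_left_mono)
  moreover have "(\<alpha> - \<alpha>\<^sup>2) * ln 800 \<le> 1 * ln 800"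
    using c by (intro mult_right_mono) auto
  moreover have "(1 - \<alpha>) * ln 2 \<le> 1 * ln 2" "\<alpha> * ln 9 \<le> 1 * ln 9"
    using \<alpha> by (intro mult_right_mono; auto)+
  moreover have "ln 172800 = ln 2 + ln 9 + ln 12 + ln (800::real)"
    using ln_mult[of "216::real" 800] ln_mult[of "18::real" 12] ln_mult[of "2::real" 9] by simp
  moreover have "0 \<le> (1 - \<alpha>)\<^sup>2 * a"
    using a by simp
  ultimately show ?thesis
    by (simp only: power2_eq_square algebra_simps)
qed

text \<open>\<open>J\<close> of size \<open>m * M powr (1 - \<alpha>)\<close> balances the two
  errors: both \<open>(M * J) powr \<alpha>\<close> and \<open>M * m * J powr (\<alpha> - 1)\<close>
  are then bounded by multiples of \<open>X\<close>.\<close>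

lemma grid_constant_bound:
  fixes n m M :: nat and J H \<alpha> \<Lambda> :: real
  assumes \<alpha>: "1 / 2 < \<alpha>" "\<alpha> \<le> 1" and n: "1 \<le> n" "1 \<le> m" "1 \<le> M"
    and M: "real M \<le> 800 * real n powr (3 / 2)" and H: "0 < H"
    and J: "real m * real M powr (1 - \<alpha>) \<le> J" "J \<le> 2 * (real m * real M powr (1 - \<alpha>))"
    and main: "real n * real m / 2 \<le> sqrt (real n) * H * (real M * J) powr \<alpha>
      + 4 * real M * real m * sqrt (real n) * H * J powr \<alpha> / J"
    and \<Lambda>: "\<Lambda> = (2 * real m * sqrt (real n)) powr (1 - \<alpha>) * (9 / real M) powr \<alpha>"
  shows "real n powr (\<alpha>\<^sup>2 - 1 / 2) / 172800 * \<Lambda> \<le> H"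
proof -
  define X where "X = real m powr \<alpha> * real M powr (2 * \<alpha> - \<alpha>\<^sup>2)"
  let ?y = "real m * real M powr (1 - \<alpha>)"
  have y: "0 < ?y"
    using n by simp
  then have J0: "0 < J"
    using J by linarith
  have "(real M * J) powr \<alpha> \<le> (2 * (real M * ?y)) powr \<alpha>"
    using \<alpha> J J0 n mult_left_mono[OF J(2), of "real M"] by (intro powr_mono2) auto
  also have "\<dots> = 2 powr \<alpha> * (real M * ?y) powr \<alpha>"
    by (rule powr_mult)
  also have "(real M * ?y) powr \<alpha> = X"
  proof -
    have "real M * real M powr (1 - \<alpha>) = real M powr (2 - \<alpha>)"
      using n by (simp add: powr_mult_base)
    then have "real M * ?y = real m * real M powr (2 - \<alpha>)"
      by (metis mult.left_commute)
    moreover have "(2 - \<alpha>) * \<alpha> = 2 * \<alpha> - \<alpha>\<^sup>2"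
      by (simp add: power2_eq_square algebra_simps)
    ultimately show ?thesis
      by (simp only: X_def powr_mult powr_powr)
  qed
  also have "2 powr \<alpha> * X \<le> 2 powr 1 * X"
    using \<alpha> by (intro mult_right_mono powr_mono) (auto simp: X_def)
  finally have 1: "(real M * J) powr \<alpha> \<le> 2 * X"
    by simp
  have "J powr \<alpha> / J = J powr (\<alpha> - 1)"
    using J0 by (simp add: powr_diff)
  also have "\<dots> \<le> ?y powr (\<alpha> - 1)"
    using y J \<alpha> by (intro powr_mono2') auto
  finally have "real M * real m * (J powr \<alpha> / J) \<le> real M * real m * ?y powr (\<alpha> - 1)"
    by (intro mult_left_mono) auto
  also have "\<dots> = (real m * real m powr (\<alpha> - 1)) * (real M * real M powr ((1 - \<alpha>) * (\<alpha> - 1)))"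
    by (simp add: powr_mult powr_powr)
  also have "\<dots> = X"
  proof -
    have "1 + (1 - \<alpha>) * (\<alpha> - 1) = 2 * \<alpha> - \<alpha>\<^sup>2"
      by (simp add: power2_eq_square algebra_simps)
    then show ?thesis
      using n by (simp add: powr_mult_base X_def)
  qed
  finally have 2: "real M * real m * (J powr \<alpha> / J) \<le> X" .
  have sn: "0 < sqrt (real n)"
    using n by simp
  have "sqrt (real n) * (sqrt (real n) * real m / 2) = real n * real m / 2"
    by (simp flip: mult.assoc)
  also have "\<dots> \<le> sqrt (real n) * H * (real M * J) powr \<alpha>
      + 4 * real M * real m * sqrt (real n) * H * J powr \<alpha> / J"
    by (rule main)
  also have "\<dots> = sqrt (real n) * (H * (real M * J) powr \<alpha> + 4 * H * (real M * real m * (J powr \<alpha> / J)))"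
    by (simp add: algebra_simps)
  also have "\<dots> \<le> sqrt (real n) * (H * (2 * X) + 4 * H * X)"
    using 1 2 H by (intro mult_left_mono add_mono) auto
  finally have key: "sqrt (real n) * real m \<le> H * (12 * X)"
    using sn by (simp add: mult_le_cancel_left)
  define a \<mu> l where "a = ln (real n)" and "\<mu> = ln (real m)" and "l = ln (real M)"
  have e: "sqrt (real n) = exp (a / 2)" "real m = exp \<mu>"
    using n by (simp_all add: a_def \<mu>_def powr_def flip: powr_half_sqrt)
  have "l \<le> ln (800 * real n powr (3 / 2))"
    unfolding l_def using M n by (intro ln_mono) auto
  also have "\<dots> = ln 800 + 3 / 2 * a"
    using n by (simp add: ln_mult a_def)
  finally have l: "l \<le> ln 800 + 3 / 2 * a" .
  have "real n powr (\<alpha>\<^sup>2 - 1 / 2) / 172800 * \<Lambda> * (12 * X) =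
      exp ((\<alpha>\<^sup>2 - 1 / 2) * a - ln 172800 + (1 - \<alpha>) * (ln 2 + \<mu> + a / 2) + \<alpha> * (ln 9 - l)
        + ln 12 + \<alpha> * \<mu> + (2 * \<alpha> - \<alpha>\<^sup>2) * l)"
  proof -
    have "real n powr (\<alpha>\<^sup>2 - 1 / 2) = exp ((\<alpha>\<^sup>2 - 1 / 2) * a)"
      "X = exp (\<alpha> * \<mu>) * exp ((2 * \<alpha> - \<alpha>\<^sup>2) * l)"
      using n by (auto simp: powr_def a_def \<mu>_def l_def X_def)
    moreover have "(2 * real m * sqrt (real n)) powr (1 - \<alpha>) = exp ((1 - \<alpha>) * (ln 2 + \<mu> + a / 2))"
      using n by (simp add: powr_def ln_mult ln_sqrt a_def \<mu>_def)
    moreover have "(9 / real M) powr \<alpha> = exp (\<alpha> * (ln 9 - l))"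
      using n by (simp add: powr_def ln_div l_def)
    ultimately show ?thesis
      by (simp add: \<Lambda> exp_add exp_diff)
  qed
  also have "\<dots> \<le> exp (a / 2 + \<mu>)"
    using grid_exponent_bound[OF \<alpha> _ l, of \<mu>] n by (simp add: a_def)
  also have "\<dots> = sqrt (real n) * real m"
    by (simp add: e exp_add)
  also note key
  finally show ?thesis
    using n by (simp add: X_def mult.commute)
qed

lemma grid_extension_lower:
  assumes n: "1 \<le> n" and \<alpha>: "1 / 2 < \<alpha>" "\<alpha> \<le> 1" and Z: "contains_euclidean n Z"
  obtains S where "S \<noteq> {}" "finite S" "real (card S) \<le> (1600 * real n ^ 3) ^ n"
    "ennreal (real n powr (\<alpha>\<^sup>2 - 1 / 2) / 172800) \<le> ext_modulus_from \<alpha> ell_infty S Z"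
proof -
  obtain M m :: nat where Mm: "real M \<le> 800 * real n powr (3 / 2)" "m = M * n" "1 \<le> M"
    "2 * real m \<le> 1600 * real n ^ 3" "((2 * real m)\<^sup>2) ^ n \<le> exp (7 * real M / 72)"
    by (rule sign_matrix_parameters[OF n])
  have m: "1 \<le> m"
    using Mm n by simp
  let ?T = "int_box n (2 * m)"
  \<comment> \<open>The sign matrix must act well on differences of grid points, so the union bound
    runs over ordered pairs.\<close>
  define D where "D = {(x, y) \<in> ?T \<times> ?T. x \<noteq> y}"
  define diff :: "(nat \<Rightarrow> int) \<times> (nat \<Rightarrow> int) \<Rightarrow> nat \<Rightarrow> real"
    where "diff = (\<lambda>p i. real_of_int (fst p i) - real_of_int (snd p i))"
  have "finite D"
    by (rule finite_subset[of _ "?T \<times> ?T"]) (auto simp: D_def)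
  have "card D \<le> card (?T \<times> ?T)"
    by (rule card_mono) (auto simp: D_def)
  then have "real (card D) \<le> real (card (?T \<times> ?T))"
    by (rule of_nat_mono)
  also have "\<dots> = ((2 * real m)\<^sup>2) ^ n"
    by (simp only: card_cartesian_product card_int_box of_nat_mult of_nat_power power2_eq_square
        power_mult_distrib of_nat_numeral)
  also have "\<dots> \<le> exp (7 * real M / 72)"
    by (rule Mm)
  finally have card_D: "real (card D) \<le> exp (7 * real M / 72)" .
  have pos_D: "0 < L2_set (diff p) {..<n}" if "p \<in> D" for p
  proof -
    obtain x y where xy: "p = (x, y)" "x \<in> ?T" "y \<in> ?T" "x \<noteq> y"
      using \<open>p \<in> D\<close> by (auto simp: D_def)
    then obtain i where "x i \<noteq> y i"
      by blast
    moreover from this have "i < n"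
      using xy by (cases "i < n") (auto simp: int_box_def)
    ultimately have "L2_set (diff p) {..<n} \<noteq> 0"
      by (auto simp: L2_set_eq_0_iff diff_def xy)
    then show ?thesis
      by (simp add: less_le)
  qed
  obtain B where B: "\<forall>k i. B k i = 1 \<or> B k i = (- 1 :: int)"
    "\<forall>p\<in>D. real M / 9 * L2_set (diff p) {..<n} \<le> (\<Sum>k<M. \<bar>\<Sum>i<n. real_of_int (B k i) * diff p i\<bar>)"
    by (rule sign_matrix_exists[OF \<open>finite D\<close> card_D pos_D])
  define pos where "pos = sign_image n M B"
  define \<Lambda> where "\<Lambda> = (2 * real m * sqrt (real n)) powr (1 - \<alpha>) * (9 / real M) powr \<alpha>"
  have \<Lambda>: "0 < \<Lambda>"
    using n m Mm by (simp add: \<Lambda>_def)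
  show thesis
  proof (rule ext_modulus_from_lower[where pos = pos and \<phi> = "\<lambda>t i. real_of_int (t i)" and n = n
        and M = M and \<alpha> = \<alpha> and \<kappa> = "real n powr (\<alpha>\<^sup>2 - 1 / 2) / 172800" and T = ?T, OF Z finite_int_box _ \<Lambda>])
    have "(\<lambda>_. 0) \<in> ?T"
      using m by (simp add: int_box_def)
    then show "?T \<noteq> {}"
      by blast
    show "real_of_int (t i) = 0" if "t \<in> ?T" "n \<le> i" for t i
      using that by (auto simp: int_box_def)
    show "L2_set (\<lambda>i. real_of_int (s i) - real_of_int (t i)) {..<n} \<le> \<Lambda> * ldist M (pos s) (pos t) powr \<alpha>"
      if st: "s \<in> ?T" "t \<in> ?T" for s t
    proof (cases "s = t")
      case False
      let ?\<delta> = "L2_set (\<lambda>i. real_of_int (s i) - real_of_int (t i)) {..<n}"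
      let ?d = "ldist M (pos s) (pos t)"
      have "(s, t) \<in> D"
        using st False by (simp add: D_def)
      from bspec[OF B(2) this] have "real M / 9 * ?\<delta> \<le> ?d"
        by (simp add: diff_def pos_def ldist_sign_image)
      then have "?\<delta> \<le> 9 / real M * ?d"
        using Mm by (simp add: field_simps)
      then have 1: "?\<delta> powr \<alpha> \<le> (9 / real M) powr \<alpha> * ?d powr \<alpha>"
        using \<alpha> by (subst powr_mult[symmetric]) (auto intro!: powr_mono2)
      have "?\<delta> \<le> 2 * real m * sqrt (real n)"
      proof (rule L2_set_le_bound)
        fix i assume "i < n"
        then have "\<bar>s i - t i\<bar> \<le> 2 * int m"
          using st by (force simp: int_box_def)
        then show "\<bar>real_of_int (s i) - real_of_int (t i)\<bar> \<le> 2 * real m"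
          by linarith
      qed simp
      then have 2: "?\<delta> powr (1 - \<alpha>) \<le> (2 * real m * sqrt (real n)) powr (1 - \<alpha>)"
        using \<alpha> by (intro powr_mono2) auto
      \<comment> \<open>Interpolation: the power \<open>1 - \<alpha>\<close> is bounded by the
        diameter of the grid, the power \<open>\<alpha>\<close> by the lower bound for the sign
        matrix. This is the origin of \<open>\<Lambda>\<close>.\<close>
      have "?\<delta> = ?\<delta> powr (1 - \<alpha>) * ?\<delta> powr \<alpha>"
        by (simp flip: powr_add)
      also have "\<dots> \<le> (2 * real m * sqrt (real n)) powr (1 - \<alpha>) * ((9 / real M) powr \<alpha> * ?d powr \<alpha>)"
        using 1 2 by (intro mult_mono) auto
      finally show ?thesis
        by (simp add: \<Lambda>_def mult.assoc)
    qed (simp add: L2_set_def)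
  next
    fix F :: "(nat \<Rightarrow> int) \<Rightarrow> nat \<Rightarrow> real" and H :: real
    assume H: "0 < H" and ext: "\<And>t i. t \<in> ?T \<Longrightarrow> i < n \<Longrightarrow> F (pos t) i = real_of_int (t i)"
      and F: "\<And>v w. L2_set (\<lambda>i. F v i - F w i) {..<n} \<le> H * ldist M v w powr \<alpha>"
    let ?y = "real m * real M powr (1 - \<alpha>)"
    \<comment> \<open>Rounding up loses at most a factor 2 because \<open>?y \<ge> 1\<close>;
      moreover \<open>?y \<ge> m = M * n \<ge> M * sqrt n\<close>.\<close>
    define J where "J = nat \<lceil>?y\<rceil>"
    have "1 \<le> real M powr (1 - \<alpha>)"
      using Mm \<alpha> by (intro ge_one_powr_ge_zero) auto
    then have y: "real m \<le> ?y"
      using mult_left_mono[of 1 "real M powr (1 - \<alpha>)" "real m"] by simp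
    have "1 \<le> ?y"
      using y m by linarith
    then have J: "?y \<le> real J" "real J \<le> 2 * ?y" "0 < J"
      unfolding J_def by linarith+
    have "sqrt (real n) \<le> real n"
      using n by (intro real_le_lsqrt) (auto simp: power2_eq_square)
    then have "real M * sqrt (real n) \<le> real m"
      by (simp add: Mm(2) mult_left_mono)
    with y J have MJ: "real M * sqrt (real n) \<le> real J"
      by linarith
    have "real n * real m / 2 \<le> sqrt (real n) * H * (real M * real J) powr \<alpha>
      + 4 * real M * real m * sqrt (real n) * H * real J powr \<alpha> / real J"
      by (rule grid_increment_bound[OF n m \<open>0 < J\<close> MJ _ _ B(1)[rule_format] F]) (use H \<alpha> ext in \<open>auto simp: pos_def\<close>)
    from grid_constant_bound[OF \<alpha> n m Mm(3) Mm(1) H J(1,2) this \<Lambda>_def]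
    show "real n powr (\<alpha>\<^sup>2 - 1 / 2) / 172800 * \<Lambda> \<le> H" .
  next
    fix S assume S: "S \<noteq> {}" "finite S" "card S \<le> card ?T"
      "ennreal (real n powr (\<alpha>\<^sup>2 - 1 / 2) / 172800) \<le> ext_modulus_from \<alpha> ell_infty S Z"
    have "real (card S) \<le> real (card ?T)"
      using S by simp
    also have "\<dots> = (2 * real m) ^ n"
      by (simp add: card_int_box)
    also have "\<dots> \<le> (1600 * real n ^ 3) ^ n"
      using Mm by (intro power_mono) auto
    finally show thesis
      using S by (intro that[of S])
  qed
qed

section \<open>Assembling the bounds\<close>

lemma ennreal_half_sum_le:
  assumes "ennreal (A / C) \<le> E" "ennreal (B / C) \<le> E" "0 < C"
  shows "ennreal (1 / (2 * C) * (A + B)) \<le> E"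
proof -
  have "1 / (2 * C) * (A + B) \<le> max (A / C) (B / C)"
    using \<open>0 < C\<close> by (simp add: field_simps max_def)
  then have "ennreal (1 / (2 * C) * (A + B)) \<le> ennreal (max (A / C) (B / C))"
    by (rule ennreal_leI)
  also have "\<dots> \<le> E"
    using assms by (simp add: max_def)
  finally show ?thesis .
qed

lemma ennreal_divide_le:
  assumes "ennreal (A / C) \<le> E" "0 \<le> B" "B \<le> K * A" "0 < C" "0 < K" "K * C \<le> D"
  shows "ennreal (B / D) \<le> E"
proof -
  have "B / D \<le> (K * A) / (K * C)"
    using assms by (intro frac_le) auto
  also have "\<dots> = A / C"
    using \<open>0 < K\<close> by simp
  finally show ?thesis
    using assms(1) by (meson ennreal_leI order_trans)
qed

lemma ext_modulus_card_upper:
  assumes "S \<noteq> {}" "finite S" "card S \<le> N" "E \<le> ext_modulus_from \<alpha> ell_infty S Z"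
  shows "E \<le> ext_modulus_card N \<alpha> ell_infty Z"
  unfolding ext_modulus_card_def using assms by (intro SUP_upper2[of S]) auto

lemma ext_modulus_upper:
  assumes "S \<noteq> {}" "E \<le> ext_modulus_from \<alpha> ell_infty S Z"
  shows "E \<le> ext_modulus \<alpha> ell_infty Z"
  unfolding ext_modulus_def using assms by (intro SUP_upper2[of S]) auto

text \<open>For exponents in the unit interval \<open>K powr p \<le> K\<close>, which keeps the
  final constant independent of \<alpha>.\<close>

lemma powr_times_le:
  fixes x y K p :: real
  assumes "0 \<le> x" "x \<le> K * y" "1 \<le> K" "0 \<le> y" "0 \<le> p" "p \<le> 1"
  shows "x powr p \<le> K * y powr p"
proof -
  have "x powr p \<le> (K * y) powr p"
    using assms by (intro powr_mono2) auto
  also have "\<dots> = K powr p * y powr p"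
    by (rule powr_mult)
  also have "\<dots> \<le> K powr 1 * y powr p"
    using assms by (intro mult_right_mono powr_mono) auto
  finally show ?thesis
    using assms by simp
qed

lemma card_cube_lower:
  assumes \<alpha>: "1 / 2 < \<alpha>" "\<alpha> \<le> 1" and N: "3 \<le> (N::nat)"
  shows "ennreal (ln (real N) powr ((2 * \<alpha> - 1) / (4 * \<alpha>)) / 128) \<le> ext_modulus_card N \<alpha> ell_infty ell2"
proof -
  \<comment> \<open>The largest dimension whose cube has at most \<open>N\<close> points; rounding
    down a number at least 1 loses at most a factor 2.\<close>
  define d where "d = nat \<lfloor>log 2 (real N)\<rfloor>"
  have "1 \<le> log 2 (real N)"
    using N by (simp add: le_log_iff)
  then have "1 \<le> \<lfloor>log 2 (real N)\<rfloor>"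
    by (simp add: le_floor_iff)
  then have d: "1 \<le> d" "real d \<le> log 2 (real N)" "log 2 (real N) \<le> 2 * real d"
    unfolding d_def by linarith+
  have "2 ^ d \<le> real N"
    using d N by (simp add: le_log_iff powr_realpow)
  then have dN: "2 ^ d \<le> N"
    by (metis of_nat_le_iff of_nat_numeral of_nat_power)
  have "ln (real N) \<le> log 2 (real N)"
    using N ln_le_minus_one[of "2::real"] mult_left_le[of "ln 2" "ln (real N)"]
    by (simp add: log_def pos_le_divide_eq)
  then have "ln (real N) \<le> 2 * real d"
    using d by linarith
  moreover have "0 \<le> (2 * \<alpha> - 1) / (4 * \<alpha>)" "(2 * \<alpha> - 1) / (4 * \<alpha>) \<le> 1"
    using \<alpha> by (auto simp: field_simps)
  ultimately have le: "ln (real N) powr ((2 * \<alpha> - 1) / (4 * \<alpha>)) \<le> 2 * real d powr ((2 * \<alpha> - 1) / (4 * \<alpha>))"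
    using N by (intro powr_times_le) auto
  obtain S where S: "S \<noteq> {}" "finite S" "card S \<le> 2 ^ d"
    "ennreal (real d powr ((2 * \<alpha> - 1) / (4 * \<alpha>)) / 64) \<le> ext_modulus_from \<alpha> ell_infty S ell2"
    by (rule cube_extension_lower[OF d(1) \<alpha> contains_euclidean_ell2])
  have "ennreal (ln (real N) powr ((2 * \<alpha> - 1) / (4 * \<alpha>)) / 128) \<le> ext_modulus_from \<alpha> ell_infty S ell2"
    by (rule ennreal_divide_le[OF S(4) _ le]) auto
  then show ?thesis
    using S dN by (intro ext_modulus_card_upper[of S]) auto
qed

text \<open>A grid with at most \<open>N\<close> points serves when \<open>ln N / ln (ln N)\<close>
  is large. Otherwise its power is bounded and the cube bound suffices; the term
  \<open>3 / ln (ln 3)\<close> in \<open>C\<close> covers small \<open>N\<close>, where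
  \<open>ln (ln N)\<close> is close to 0.\<close>

lemma card_grid_lower:
  assumes \<alpha>: "1 / 2 < \<alpha>" "\<alpha> \<le> 1" and N: "3 \<le> (N::nat)"
  defines "C \<equiv> 5000000 * (1 + 3 / ln (ln 3))"
  shows "ennreal ((ln (real N) / ln (ln (real N))) powr (\<alpha>\<^sup>2 - 1 / 2) / C) \<le> ext_modulus_card N \<alpha> ell_infty ell2"
proof -
  let ?E = "ext_modulus_card N \<alpha> ell_infty ell2"
  define l x p where "l = ln (ln (real N))" and "x = ln (real N) / l" and "p = \<alpha>\<^sup>2 - 1 / 2"
  have ln3: "1 < ln (3::real)"
    by (rule ln3_gt_1)
  then have lnln3: "0 < ln (ln (3::real))"
    by simp
  have lnN: "ln 3 \<le> ln (real N)"
    using N by simp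
  then have l: "ln (ln 3) \<le> l"
    unfolding l_def by (rule ln_mono) (use lnN ln3 in linarith)+
  then have l0: "0 < l"
    using lnln3 by linarith
  have "l \<le> ln (real N)"
    unfolding l_def using lnN ln3 ln_le_minus_one[of "ln (real N)"] by linarith
  then have x1: "1 \<le> x"
    using l0 by (simp add: x_def)
  have \<alpha>2: "\<alpha>\<^sup>2 \<le> 1"
    using \<alpha> by (simp add: power_le_one)
  then have p: "p \<le> 1"
    by (simp add: p_def)
  have C: "5000000 \<le> C" "5000000 * (3 / ln (ln 3)) \<le> C"
    using lnln3 by (simp_all add: C_def)
  have base: "ennreal (1 / 128) \<le> ?E"
  proof (rule ennreal_divide_le[OF card_cube_lower[OF \<alpha> N], of _ 1])
    show "1 \<le> 1 * ln (real N) powr ((2 * \<alpha> - 1) / (4 * \<alpha>))"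
      using lnN ln3 \<alpha> by (simp add: ge_one_powr_ge_zero)
  qed auto
  have small: "ennreal (x powr p / C) \<le> ?E" if "x powr p \<le> K" "128 * K \<le> C" "0 < K" for K
    using that by (intro ennreal_divide_le[OF base, of _ K]) (auto simp: mult.commute)
  consider "p \<le> 0" | "0 < p" "l < 1" | "0 < p" "1 \<le> l" "x < 14" | "0 < p" "1 \<le> l" "14 \<le> x"
    by linarith
  \<comment> \<open>The exponent \<open>p\<close> is negative for \<open>\<alpha>\<close> below
    \<open>1 / sqrt 2\<close>. The first three cases bound \<open>x powr p\<close> by a constant and
    use \<open>base\<close>.\<close>
  then have "ennreal (x powr p / C) \<le> ?E"
  proof cases
    case 1
    then have "x powr p \<le> x powr 0"
      using x1 by (intro powr_mono) auto
    then show ?thesis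
      using x1 C by (intro small[of 1]) auto
  next
    case 2
    have "ln (real N) = exp l"
      using lnN ln3 by (simp add: l_def)
    also have "\<dots> \<le> 3"
      using 2 exp_le by (meson exp_le_cancel_iff less_imp_le order_trans)
    finally have "x \<le> 3 / ln (ln 3)"
      unfolding x_def using l lnln3 lnN ln3 by (intro frac_le) auto
    moreover have "x powr p \<le> x"
      using powr_mono[of p 1 x] p x1 by simp
    ultimately show ?thesis
      using C lnln3 by (intro small[of "3 / ln (ln 3)"]) auto
  next
    case 3
    have "x powr p \<le> x"
      using powr_mono[of p 1 x] p x1 by simp
    then show ?thesis
      using 3 C by (intro small[of 14]) auto
  next
    case 4
    \<comment> \<open>Since \<open>ln 1600 \<le> 11\<close>, \<open>ln d \<le> l\<close> and
      \<open>1 \<le> l\<close>, the logarithm of \<open>1600 * d ^ 3\<close> is at most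
      \<open>(11 + 3) * l\<close>; this is the 14. Rounding down makes it 28, and
      \<open>28 * 172800 \<le> 5000000\<close>.\<close>
    define d where "d = nat \<lfloor>x / 14\<rfloor>"
    have "1 \<le> x / 14"
      using 4 by simp
    then have "1 \<le> \<lfloor>x / 14\<rfloor>"
      by (simp add: le_floor_iff)
    then have d: "1 \<le> d" "real d \<le> x / 14" "x \<le> 28 * real d"
      unfolding d_def by linarith+
    have "x \<le> ln (real N)"
      unfolding x_def using 4 lnN ln3 l0 by (simp add: divide_le_eq_1 field_simps)
    then have "real d \<le> ln (real N)"
      using d x1 by linarith
    then have "ln (real d) \<le> l"
      unfolding l_def by (rule ln_mono) (use d in linarith)+
    moreover have "ln (1600::real) \<le> 11"
    proof -
      have "ln (1600::real) \<le> ln (2 ^ 11)"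
        by (subst ln_le_cancel_iff) auto
      also have "\<dots> = 11 * ln 2"
        by (subst ln_realpow) auto
      also have "\<dots> \<le> 11"
        using ln_le_minus_one[of "2::real"] by simp
      finally show ?thesis .
    qed
    ultimately have "ln (1600 * real d ^ 3) \<le> 14 * l"
      using d 4 by (simp add: ln_mult ln_realpow)
    then have "real d * ln (1600 * real d ^ 3) \<le> real d * (14 * l)"
      by (intro mult_left_mono) auto
    also have "\<dots> \<le> (x / 14) * (14 * l)"
      using d l0 by (intro mult_right_mono) auto
    also have "\<dots> = ln (real N)"
      using l0 by (simp add: x_def)
    finally have "ln ((1600 * real d ^ 3) ^ d) \<le> ln (real N)"
      using d by (subst ln_realpow) auto
    then have dN: "(1600 * real d ^ 3) ^ d \<le> real N"
      using d N by (subst (asm) ln_le_cancel_iff) auto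
    obtain S where S: "S \<noteq> {}" "finite S" "real (card S) \<le> (1600 * real d ^ 3) ^ d"
      "ennreal (real d powr p / 172800) \<le> ext_modulus_from \<alpha> ell_infty S ell2"
      unfolding p_def by (rule grid_extension_lower[OF d(1) \<alpha> contains_euclidean_ell2])
    have "x powr p \<le> 28 * real d powr p"
      using d 4 x1 p by (intro powr_times_le) auto
    then have "ennreal (x powr p / C) \<le> ext_modulus_from \<alpha> ell_infty S ell2"
      using C by (intro ennreal_divide_le[OF S(4)]) auto
    moreover have "card S \<le> N"
      using S(3) dN by linarith
    ultimately show ?thesis
      using S by (intro ext_modulus_card_upper[of S]) auto
  qed
  then show ?thesis
    by (simp add: x_def l_def p_def)
qed

theorem theorem4:
  shows "\<exists>c::real. 0 < c \<and> (\<forall>\<alpha>::real. 1 / 2 < \<alpha> \<and> \<alpha> \<le> 1 \<longrightarrow>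
           (\<forall>n::nat. 1 \<le> n \<longrightarrow>
              ext_modulus \<alpha> ell_infty (ell2_dim n) \<ge>
                ennreal (c * (real n powr ((2 * \<alpha> - 1) / (4 * \<alpha>)) + real n powr (\<alpha>\<^sup>2 - 1 / 2)))) \<and>
           (\<forall>n::nat. 3 \<le> n \<longrightarrow>
              ext_modulus_card n \<alpha> ell_infty ell2 \<ge>
                ennreal (c * (ln (real n) powr ((2 * \<alpha> - 1) / (4 * \<alpha>))
                  + (ln (real n) / ln (ln (real n))) powr (\<alpha>\<^sup>2 - 1 / 2)))))"
proof -
  \<comment> \<open>The constant of \<open>card_grid_lower\<close>, which also dominates 64, 128 and
    172800. The further factor 2 in \<open>1 / (2 * C)\<close> pays for bounding a sum by twice its
    larger term.\<close>
  define C :: real where "C = 5000000 * (1 + 3 / ln (ln 3))"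
  have "1 < ln (3::real)"
    by (rule ln3_gt_1)
  then have C: "5000000 \<le> C"
    by (simp add: C_def)
  show ?thesis
  proof (intro exI[of _ "1 / (2 * C)"] conjI allI impI)
    show "0 < 1 / (2 * C)"
      using C by simp
  next
    fix \<alpha> :: real and n :: nat
    assume "1 / 2 < \<alpha> \<and> \<alpha> \<le> 1" and n: "1 \<le> n"
    then have \<alpha>: "1 / 2 < \<alpha>" "\<alpha> \<le> 1"
      by auto
    obtain S where S: "S \<noteq> {}"
      "ennreal (real n powr ((2 * \<alpha> - 1) / (4 * \<alpha>)) / 64) \<le> ext_modulus_from \<alpha> ell_infty S (ell2_dim n)"
      by (rule cube_extension_lower[OF n \<alpha> contains_euclidean_ell2_dim])
    obtain S' where S': "S' \<noteq> {}"
      "ennreal (real n powr (\<alpha>\<^sup>2 - 1 / 2) / 172800) \<le> ext_modulus_from \<alpha> ell_infty S' (ell2_dim n)"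
      by (rule grid_extension_lower[OF n \<alpha> contains_euclidean_ell2_dim])
    show "ext_modulus \<alpha> ell_infty (ell2_dim n) \<ge>
        ennreal (1 / (2 * C) * (real n powr ((2 * \<alpha> - 1) / (4 * \<alpha>)) + real n powr (\<alpha>\<^sup>2 - 1 / 2)))"
    proof (rule ennreal_half_sum_le)
      show "ennreal (real n powr ((2 * \<alpha> - 1) / (4 * \<alpha>)) / C) \<le> ext_modulus \<alpha> ell_infty (ell2_dim n)"
        using C by (intro ennreal_divide_le[OF ext_modulus_upper[OF S], of _ 1]) auto
      show "ennreal (real n powr (\<alpha>\<^sup>2 - 1 / 2) / C) \<le> ext_modulus \<alpha> ell_infty (ell2_dim n)"
        using C by (intro ennreal_divide_le[OF ext_modulus_upper[OF S'], of _ 1]) auto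
    qed (use C in auto)
  next
    fix \<alpha> :: real and n :: nat
    assume \<alpha>: "1 / 2 < \<alpha> \<and> \<alpha> \<le> 1" and n: "3 \<le> n"
    show "ext_modulus_card n \<alpha> ell_infty ell2 \<ge>
        ennreal (1 / (2 * C) * (ln (real n) powr ((2 * \<alpha> - 1) / (4 * \<alpha>))
          + (ln (real n) / ln (ln (real n))) powr (\<alpha>\<^sup>2 - 1 / 2)))"
    proof (rule ennreal_half_sum_le)
      show "ennreal (ln (real n) powr ((2 * \<alpha> - 1) / (4 * \<alpha>)) / C) \<le> ext_modulus_card n \<alpha> ell_infty ell2"
        using \<alpha> n C by (intro ennreal_divide_le[OF card_cube_lower, of _ _ _ 1]) auto
      show "ennreal ((ln (real n) / ln (ln (real n))) powr (\<alpha>\<^sup>2 - 1 / 2) / C)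
          \<le> ext_modulus_card n \<alpha> ell_infty ell2"
        unfolding C_def using \<alpha> n by (intro card_grid_lower) auto
    qed (use C in auto)
  qed
qed

end
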